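(* For all integers $d,m\ge 1$, all $B>0$ and all $n\ge 1$: \begin{align*} e_n(\mathcal F_{d,m,B},S_L,D_{\mathrm{abs}})&=\Theta_{m,d}(Bn^{-m/d}), & e^{\mathrm{ad}}_n(\mathcal F_{d,m,B},S_L,D_{\mathrm{abs}})&=\Theta_{m,d}(Bn^{-m/d}),\\ e_n(\mathcal F_{d,m,B},S_{\mathrm{samp}},D_{\sup\text{-}\log})&=\Theta_{m,d}(Bn^{-m/d}), & e^{\mathrm{ad}}_n(\mathcal F_{d,m,B},S_{\mathrm{samp}},D_{\sup\text{-}\log})&=\Theta_{m,d}(Bn^{-m/d}),\\ e_n(\mathcal F_{d,m,B},S_{\mathrm{samp}},D_{\mathrm{TV}})&=\Theta_{m,d}(\min\{1,Bn^{-m/d}\}), & e^{\mathrm{ad}}_n(\mathcal F_{d,m,B},S_{\mathrm{samp}},D_{\mathrm{TV}})&=\Theta_{m,d}(\min\{1,Bn^{-m/d}\}),\\ e_n(\mathcal F_{d,m,B},S_{\mathrm{samp}},W_1)&=\Theta_{m,d}(\min\{1,Bn^{-m/d}\}), & e^{\mathrm{ad}}_n(\mathcal F_{d,m,B},S_{\mathrm{samp}},W_1)&=\Theta_{m,d}(\min\{1,Bn^{-m/d}\}). \end{align*}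
   Context: Let $\mathcal X=[0,1]^d$ with Lebesgue measure. For bounded measurable $f:\mathcal X\to\mathbb R$ let $Z_f=\int_{\mathcal X}e^{f(x)}\,dx$, $L_f=\log Z_f$, and $P_f$ the probability distribution on $\mathcal X$ with density $e^{f}/Z_f$. For $f\in C^m(\mathcal X)$, $\|f\|_{C^m}=\sup_{\alpha\in\mathbb N_0^d,|\alpha|_1\le m}\|\partial^\alpha f\|_\infty$, and $\mathcal F_{d,m,B}=\{f\in C^m(\mathcal X):\|f\|_{C^m}\le B\}$. Problems: $S_L(f)=L_f$ with metric $D_{\mathrm{abs}}(a,b)=|a-b|$ on $\mathbb R$; $S_{\mathrm{samp}}(f)=P_f$ with values in the set of probability distributions on $\mathcal X$, compared with: the sup-log distance $D_{\sup\text{-}\log}(P,Q)=\|\log(dP/dQ)\|_\infty$ (essential sup over $\mathcal X$; $=\infty$ unless $P,Q$ are mutually absolutely continuous), the total variation distance $D_{\mathrm{TV}}(P,Q)=\sup_{A\text{ measurable}}|P(A)-Q(A)|$, and the 1-Wasserstein distance $W_1(P,Q)=\inf_{X\sim P,Y\sim Q}\mathbb E\|X-Y\|_2$. Algorithms: $\mathcal A_n$ is the set of maps $\tilde S=\phi\circ N$ with $N(f)=(f(x_1),\dots,f(x_n))$ for some fixed points $x_1,\dots,x_n\in\mathcal X$ and an arbitrary map $\phi$ from $\mathbb R^n$ to the output space; $\mathcal A^{\mathrm{ad}}_n$ is the analogous set where the $k$-th point $x_k$ may depend on $f(x_1),\dots,f(x_{k-1})$. For a class $\mathcal F$, problem $S$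 and metric $D$: $e_n(\mathcal F,S,D)=\inf_{\tilde S\in\mathcal A_n}\sup_{f\in\mathcal F}D(S(f),\tilde S(f))$ and $e^{\mathrm{ad}}_n$ likewise with $\mathcal A^{\mathrm{ad}}_n$. Asymptotic notation: $g\le O_{m,d}(h)$ means that for all $m,d$ there is $C_{m,d}>0$ with $g\le C_{m,d}h$ for all $B>0$ and all $n\ge1$; $g\ge\Omega_{m,d}(h)$ means $h\le O_{m,d}(g)$; $\Theta_{m,d}$ means both. *)

theory Defs
  imports "HOL-Probability.Probability"
begin

definition cube :: "(real^'d) set" where
  "cube = {x. \<forall>i. 0 \<le> x $ i \<and> x $ i \<le> 1}"

definition has_partial_within :: "(real^'d) set \<Rightarrow> 'd \<Rightarrow> (real^'d \<Rightarrow> real) \<Rightarrow> real \<Rightarrow> real^'d \<Rightarrow> bool" where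
  "has_partial_within X i f D x \<longleftrightarrow>
     ((\<lambda>t. f (x + t *\<^sub>R axis i 1)) has_real_derivative D) (at 0 within {t. x + t *\<^sub>R axis i 1 \<in> X})"

text \<open>Cm_bdd m B X f: f is C^m on X and every partial derivative of order at most m
  is bounded by B in sup norm on X, i.e. norm of f in C^m is at most B.\<close>
primrec Cm_bdd :: "nat \<Rightarrow> real \<Rightarrow> (real^'d) set \<Rightarrow> (real^'d \<Rightarrow> real) \<Rightarrow> bool" where
  "Cm_bdd 0 B X f \<longleftrightarrow> continuous_on X f \<and> (\<forall>x\<in>X. \<bar>f x\<bar> \<le> B)"
| "Cm_bdd (Suc k) B X f \<longleftrightarrow> continuous_on X f \<and> (\<forall>x\<in>X. \<bar>f x\<bar> \<le> B) \<and>
     (\<forall>i. \<exists>g. (\<forall>x\<in>X. has_partial_within X i f (g x) x) \<and> Cm_bdd k B X g)"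

definition Fcls :: "nat \<Rightarrow> real \<Rightarrow> (real^'d \<Rightarrow> real) set" where
  "Fcls m B = {f. Cm_bdd m B cube f}"

definition Zf :: "(real^'d \<Rightarrow> real) \<Rightarrow> real" where
  "Zf f = (LINT x:cube|lborel. exp (f x))"

definition Lf :: "(real^'d \<Rightarrow> real) \<Rightarrow> real" where
  "Lf f = ln (Zf f)"

definition Pf :: "(real^'d \<Rightarrow> real) \<Rightarrow> (real^'d) measure" where
  "Pf f = density lborel (\<lambda>x. ennreal (indicator cube x * exp (f x) / Zf f))"

definition Dists :: "(real^'d) measure set" where
  "Dists = {M. sets M = sets borel \<and> prob_space M \<and> emeasure M cube = 1}"

definition abs_dist :: "real \<Rightarrow> real \<Rightarrow> ereal" where
  "abs_dist a b = ereal \<bar>a - b\<bar>"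

definition suplog_dist :: "(real^'d) measure \<Rightarrow> (real^'d) measure \<Rightarrow> ereal" where
  "suplog_dist P Q =
     (if absolutely_continuous P Q \<and> absolutely_continuous Q P
      then esssup Q (\<lambda>x. ereal \<bar>ln (enn2real (RN_deriv Q P x))\<bar>)
      else \<infinity>)"

definition tv_dist :: "(real^'d) measure \<Rightarrow> (real^'d) measure \<Rightarrow> ereal" where
  "tv_dist P Q = ereal (SUP A\<in>sets (borel :: (real^'d) measure). \<bar>measure P A - measure Q A\<bar>)"

definition couplings :: "(real^'d) measure \<Rightarrow> (real^'d) measure \<Rightarrow> ((real^'d) \<times> (real^'d)) measure set" where
  "couplings P Q = {\<pi>. sets \<pi> = sets borel \<and> prob_space \<pi> \<and>
                       distr \<pi> borel fst = P \<and> distr \<pi> borel snd = Q}"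

definition w1_dist :: "(real^'d) measure \<Rightarrow> (real^'d) measure \<Rightarrow> ereal" where
  "w1_dist P Q = enn2ereal (INF \<pi>\<in>couplings P Q. \<integral>\<^sup>+ z. ennreal (norm (fst z - snd z)) \<partial>\<pi>)"

definition err_na :: "nat \<Rightarrow> 'x set \<Rightarrow> ('x \<Rightarrow> real) set \<Rightarrow> (('x \<Rightarrow> real) \<Rightarrow> 'o) \<Rightarrow> 'o set
                       \<Rightarrow> ('o \<Rightarrow> 'o \<Rightarrow> ereal) \<Rightarrow> ereal" where
  "err_na n X F S Out D =
     (INF xs\<in>{xs. length xs = n \<and> set xs \<subseteq> X}. INF \<phi>\<in>{\<phi>. \<forall>v. \<phi> v \<in> Out}.
        SUP f\<in>F. D (S f) (\<phi> (map f xs)))"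

primrec ad_info :: "(real list \<Rightarrow> 'x) \<Rightarrow> ('x \<Rightarrow> real) \<Rightarrow> nat \<Rightarrow> real list" where
  "ad_info pt f 0 = []"
| "ad_info pt f (Suc k) = ad_info pt f k @ [f (pt (ad_info pt f k))]"

definition err_ad :: "nat \<Rightarrow> 'x set \<Rightarrow> ('x \<Rightarrow> real) set \<Rightarrow> (('x \<Rightarrow> real) \<Rightarrow> 'o) \<Rightarrow> 'o set
                       \<Rightarrow> ('o \<Rightarrow> 'o \<Rightarrow> ereal) \<Rightarrow> ereal" where
  "err_ad n X F S Out D =
     (INF pt\<in>{pt. \<forall>v. pt v \<in> X}. INF \<phi>\<in>{\<phi>. \<forall>v. \<phi> v \<in> Out}.
        SUP f\<in>F. D (S f) (\<phi> (ad_info pt f n)))"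

definition Theta :: "(real \<Rightarrow> nat \<Rightarrow> ereal) \<Rightarrow> (real \<Rightarrow> nat \<Rightarrow> real) \<Rightarrow> bool" where
  "Theta e h \<longleftrightarrow>
     (\<exists>C>0. \<forall>B>0. \<forall>n\<ge>1. e B n \<le> ereal (C * h B n)) \<and>
     (\<exists>C>0. \<forall>B>0. \<forall>n\<ge>1. ereal (h B n) \<le> ereal C * e B n)"

end

theory Submission
  imports Defs
begin

text \<open>
  Upper bounds: on a grid with at most \<open>n\<close> points, answer with \<open>S g\<close> for any \<open>g\<close> in the class that
  matches the data. The difference \<open>f - g\<close> has bounded derivatives of order \<open>m\<close> and vanishes on the
  grid, so it is of size \<open>\<delta> = O(B * n powr (- m/d))\<close>; no interpolation operator is needed. Along a
  single coordinate this follows by induction on \<open>m\<close>: the mean value theorem on consecutive pairs of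
  \<open>2^m\<close> separated points yields \<open>2^(m-1)\<close> separated points where the derivative is small. The
  remaining coordinates are freed one at a time. The log-densities of \<open>P\<^sub>f\<close> and \<open>P\<^sub>g\<close> then
  differ by at most \<open>2\<delta>\<close>, so \<open>P\<^sub>f\<close> is a mixture of \<open>P\<^sub>g\<close>, with weight \<open>exp (- 2\<delta>)\<close>, and
  another distribution on the cube; this bounds both the total variation and the transport cost.

  Lower bounds: place bumps of height of order \<open>B * n powr (- m/d)\<close> in the cells of the half cube
  \<open>x $ i \<le> 1/2\<close> that contain no point queried for the zero function. The result \<open>f\<close> cannot be told
  apart from \<open>0\<close>. Jensen's inequality gives \<open>ln Z\<^sub>f \<ge> c * B * n powr (- m/d)\<close>, and every
  expectation of a function supported in the other half is divided by \<open>Z\<^sub>f\<close>.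
\<close>

section \<open>The unit cube\<close>

lemma zero_in_cube [simp]: "0 \<in> cube"
  by (simp add: cube_def)

lemma cube_eq_cbox: "cube = cbox 0 (1 :: real^'d)"
  by (auto simp: cube_def mem_box_cart)

lemma compact_cube: "compact (cube :: (real^'d) set)"
  by (simp add: cube_eq_cbox)

lemma sets_borel_cube: "cube \<in> sets borel"
  by (simp add: cube_eq_cbox)

lemma measure_lborel_cube: "measure lborel (cube :: (real^'d) set) = 1"
  unfolding cube_eq_cbox by (subst content_cbox_cart) (auto simp: interval_ne_empty_cart)

lemma set_integrable_cube:
  fixes f :: "real^'d \<Rightarrow> real"
  shows "continuous_on cube f \<Longrightarrow> set_integrable lborel cube f"
  unfolding set_integrable_def using borel_integrable_compact[OF compact_cube, of f] by simp

section \<open>The sampling inequality on an interval\<close>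

definition derivative_chain :: "nat \<Rightarrow> (nat \<Rightarrow> real \<Rightarrow> real) \<Rightarrow> real set \<Rightarrow> bool" where
  "derivative_chain m G S \<longleftrightarrow>
     (\<forall>l<m. \<forall>t\<in>S. (G l has_real_derivative G (Suc l) t) (at t within S))"

lemma derivative_chain_subset:
  "derivative_chain m G S \<Longrightarrow> T \<subseteq> S \<Longrightarrow> derivative_chain m G T"
  unfolding derivative_chain_def by (blast intro: has_field_derivative_subset)

lemma derivative_chain_Suc_iff:
  "derivative_chain (Suc m) G S \<longleftrightarrow>
     (\<forall>t\<in>S. (G 0 has_real_derivative G 1 t) (at t within S)) \<and>
     derivative_chain m (\<lambda>l. G (Suc l)) S"
  unfolding derivative_chain_def by (auto simp: less_Suc_eq_0_disj)

definition separated :: "real \<Rightarrow> nat \<Rightarrow> (nat \<Rightarrow> real) \<Rightarrow> bool" where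
  "separated \<delta> k x \<longleftrightarrow> (\<forall>i. Suc i < k \<longrightarrow> x i + \<delta> \<le> x (Suc i))"

lemma small_derivative_between:
  fixes g g' :: "real \<Rightarrow> real"
  assumes deriv: "\<And>s. s \<in> {x..y} \<Longrightarrow> (g has_real_derivative g' s) (at s within {x..y})"
    and gap: "0 < \<delta>" "x + \<delta> \<le> y" and small: "\<bar>g x\<bar> \<le> \<epsilon>" "\<bar>g y\<bar> \<le> \<epsilon>"
  obtains z where "z \<in> {x..y}" "\<bar>g' z\<bar> \<le> 2 * \<epsilon> / \<delta>"
proof -
  have "\<exists>z\<in>{x<..<y}. g y - g x = g' z * (y - x)"
    using deriv gap by (intro mvt_simple) (auto simp: has_field_derivative_def)
  then obtain z where z_between: "z \<in> {x<..<y}" and mvt: "g y - g x = g' z * (y - x)" by blast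
  have "\<bar>g' z\<bar> * \<delta> \<le> \<bar>g' z\<bar> * (y - x)"
    using gap by (intro mult_left_mono) auto
  also have "\<dots> = \<bar>g y - g x\<bar>" using gap by (simp add: mvt abs_mult)
  also have "\<dots> \<le> 2 * \<epsilon>" using small by linarith
  finally have "\<bar>g' z\<bar> \<le> 2 * \<epsilon> / \<delta>" using gap by (simp add: field_simps)
  with z_between show thesis by (intro that) auto
qed

lemma separated_small_derivatives:
  fixes g g' :: "real \<Rightarrow> real"
  assumes deriv: "\<And>s. s \<in> {a..b} \<Longrightarrow> (g has_real_derivative g' s) (at s within {a..b})"
    and "0 < \<delta>" and sep: "separated \<delta> (2 * k) x"
    and x_small: "\<And>i. i < 2 * k \<Longrightarrow> x i \<in> {a..b} \<and> \<bar>g (x i)\<bar> \<le> \<epsilon>"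
  obtains y where "separated \<delta> k y" "\<And>i. i < k \<Longrightarrow> y i \<in> {a..b} \<and> \<bar>g' (y i)\<bar> \<le> 2 * \<epsilon> / \<delta>"
proof -
  have "\<exists>z\<in>{x (2 * i)..x (2 * i + 1)}. \<bar>g' z\<bar> \<le> 2 * \<epsilon> / \<delta>" if "i < k" for i
  proof -
    have ends: "x (2 * i) \<in> {a..b}" "\<bar>g (x (2 * i))\<bar> \<le> \<epsilon>"
        "x (2 * i + 1) \<in> {a..b}" "\<bar>g (x (2 * i + 1))\<bar> \<le> \<epsilon>"
      using that x_small[of "2 * i"] x_small[of "2 * i + 1"] by auto
    have gap: "x (2 * i) + \<delta> \<le> x (2 * i + 1)" using sep that by (simp add: separated_def)
    have "(g has_real_derivative g' s) (at s within {x (2 * i)..x (2 * i + 1)})"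
      if "s \<in> {x (2 * i)..x (2 * i + 1)}" for s
      using ends that by (intro has_field_derivative_subset[OF deriv]) auto
    from small_derivative_between[OF this \<open>0 < \<delta>\<close> gap ends(2,4)] show ?thesis by blast
  qed
  then obtain y where y_between: "\<And>i. i < k \<Longrightarrow> y i \<in> {x (2 * i)..x (2 * i + 1)}"
      and small: "\<And>i. i < k \<Longrightarrow> \<bar>g' (y i)\<bar> \<le> 2 * \<epsilon> / \<delta>"
    by metis
  show thesis
  proof (rule that)
    show "separated \<delta> k y"
      unfolding separated_def
    proof (intro allI impI)
      fix i assume "Suc i < k"
      then have "y i \<le> x (2 * i + 1)" "x (2 * i + 2) \<le> y (Suc i)"
          "x (2 * i + 1) + \<delta> \<le> x (2 * i + 2)"
        using y_between[of i] y_between[of "Suc i"] sep by (auto simp: separated_def)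
      then show "y i + \<delta> \<le> y (Suc i)" by linarith
    qed
    show "y i \<in> {a..b} \<and> \<bar>g' (y i)\<bar> \<le> 2 * \<epsilon> / \<delta>" if "i < k" for i
      using y_between[OF that] small[OF that] x_small[of "2 * i"] x_small[of "2 * i + 1"] that
      by auto
  qed
qed

lemma abs_le_of_derivative_bound:
  fixes g g' :: "real \<Rightarrow> real"
  assumes deriv: "\<And>s. s \<in> {a..b} \<Longrightarrow> (g has_real_derivative g' s) (at s within {a..b})"
    and bound: "\<And>s. s \<in> {a..b} \<Longrightarrow> \<bar>g' s\<bar> \<le> D" and "b - a \<le> L"
    and x_small: "x \<in> {a..b}" "\<bar>g x\<bar> \<le> \<epsilon>" and t_in: "t \<in> {a..b}"
  shows "\<bar>g t\<bar> \<le> \<epsilon> + D * L"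
proof -
  have "\<bar>g t - g x\<bar> \<le> D * \<bar>t - x\<bar>"
    using field_differentiable_bound[of "{a..b}" g g' D t x] deriv bound x_small t_in by simp
  also have "\<dots> \<le> D * L"
    using bound[OF t_in] \<open>b - a \<le> L\<close> x_small t_in by (intro mult_left_mono) auto
  finally show ?thesis using x_small by linarith
qed

lemma sampling_inequality_interval:
  assumes "1 \<le> R" "0 < \<delta>" "b - a \<le> R * \<delta>"
    and "derivative_chain m G {a..b}" "\<And>s. s \<in> {a..b} \<Longrightarrow> \<bar>G m s\<bar> \<le> B"
    and "separated \<delta> (2 ^ m) x" "\<And>i. i < 2 ^ m \<Longrightarrow> x i \<in> {a..b} \<and> \<bar>G 0 (x i)\<bar> \<le> \<epsilon>"
    and "t \<in> {a..b}"
  shows "\<bar>G 0 t\<bar> \<le> (3 * R) ^ m * (\<epsilon> + B * \<delta> ^ m)"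
  using assms(4-)
proof (induction m arbitrary: G x \<epsilon> t)
  case 0
  then have "\<bar>G 0 t\<bar> \<le> B" "0 \<le> \<epsilon>" by (auto intro: order_trans[OF abs_ge_zero])
  then show ?case by simp
next
  case (Suc m)
  have deriv: "(G 0 has_real_derivative G 1 s) (at s within {a..b})" if "s \<in> {a..b}" for s
    using Suc.prems(1) that by (simp add: derivative_chain_Suc_iff)
  obtain y where y_small: "separated \<delta> (2 ^ m) y"
      "\<And>i. i < 2 ^ m \<Longrightarrow> y i \<in> {a..b} \<and> \<bar>G 1 (y i)\<bar> \<le> 2 * \<epsilon> / \<delta>"
    using separated_small_derivatives[OF deriv \<open>0 < \<delta>\<close>, of "2 ^ m" x] Suc.prems(3,4) by auto
  let ?C = "(3 * R) ^ m"
  let ?D = "?C * (2 * \<epsilon> / \<delta> + B * \<delta> ^ m)"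
  have G1_bound: "\<bar>G 1 s\<bar> \<le> ?D" if "s \<in> {a..b}" for s
    using Suc.IH[of "\<lambda>l. G (Suc l)" y "2 * \<epsilon> / \<delta>" s] Suc.prems(1,2) y_small that
    by (simp add: derivative_chain_Suc_iff)
  have x0_small: "x 0 \<in> {a..b}" "\<bar>G 0 (x 0)\<bar> \<le> \<epsilon>" using Suc.prems(4) by auto
  have "0 \<le> \<epsilon>" using x0_small by linarith
  have "0 \<le> B" using Suc.prems(2)[OF \<open>t \<in> _\<close>] by linarith
  have "\<bar>G 0 t\<bar> \<le> \<epsilon> + ?D * (R * \<delta>)"
    using deriv G1_bound assms(3) x0_small \<open>t \<in> _\<close> by (rule abs_le_of_derivative_bound)
  also have "\<dots> = \<epsilon> + ?C * R * (2 * \<epsilon> + B * \<delta> ^ Suc m)"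
    using \<open>0 < \<delta>\<close> by (simp add: field_simps)
  also have "\<dots> \<le> ?C * R * \<epsilon> + ?C * R * (2 * \<epsilon> + 3 * (B * \<delta> ^ Suc m))"
  proof (intro add_mono mult_left_mono)
    have "1 \<le> ?C * R" using \<open>1 \<le> R\<close> one_le_power[of "3 * R" m] by (intro mult_ge1_I) auto
    from mult_right_mono[OF this \<open>0 \<le> \<epsilon>\<close>] show "\<epsilon> \<le> ?C * R * \<epsilon>" by simp
  qed (use \<open>0 \<le> B\<close> \<open>0 < \<delta>\<close> \<open>1 \<le> R\<close> in auto)
  also have "\<dots> = (3 * R) ^ Suc m * (\<epsilon> + B * \<delta> ^ Suc m)" by (simp add: algebra_simps)
  finally show ?case .
qed

section \<open>Functions with bounded partial derivatives\<close>

lemma Cm_bdd_abs_le: "Cm_bdd m B X f \<Longrightarrow> x \<in> X \<Longrightarrow> \<bar>f x\<bar> \<le> B"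
  by (cases m) auto

lemma Cm_bdd_imp_continuous_on: "Cm_bdd m B X f \<Longrightarrow> continuous_on X f"
  by (cases m) auto

lemma Cm_bdd_zero: "0 \<le> B \<Longrightarrow> Cm_bdd m B X (\<lambda>_. 0)"
  by (induction m) (auto simp: has_partial_within_def intro!: exI[of _ "\<lambda>_. 0"])

lemma Cm_bdd_diff:
  "Cm_bdd m A X f \<Longrightarrow> Cm_bdd m B X g \<Longrightarrow> Cm_bdd m (A + B) X (\<lambda>x. f x - g x)"
proof (induction m arbitrary: f g)
  case 0
  then show ?case by (fastforce intro: continuous_on_diff)
next
  case (Suc m)
  have "\<exists>h. (\<forall>x\<in>X. has_partial_within X i (\<lambda>x. f x - g x) (h x) x) \<and> Cm_bdd m (A + B) X h" for i
  proof -
    obtain f' g' where "\<forall>x\<in>X. has_partial_within X i f (f' x) x" "Cm_bdd m A X f'"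
        "\<forall>x\<in>X. has_partial_within X i g (g' x) x" "Cm_bdd m B X g'"
      using Suc.prems by (auto dest!: spec[of _ i])
    then show ?thesis
      using Suc.IH unfolding has_partial_within_def
      by (intro exI[of _ "\<lambda>x. f' x - g' x"]) (auto intro: DERIV_diff)
  qed
  moreover have "\<bar>f x - g x\<bar> \<le> A + B" if "x \<in> X" for x
    using Suc.prems[THEN Cm_bdd_abs_le, OF that] by linarith
  ultimately show ?case using Suc.prems by (auto intro: continuous_on_diff)
qed

lemma Cm_bdd_cmult:
  "Cm_bdd m B X f \<Longrightarrow> Cm_bdd m (\<bar>c\<bar> * B) X (\<lambda>x. c * f x)"
proof (induction m arbitrary: f)
  case 0
  then show ?case by (auto simp: abs_mult intro: continuous_on_mult_left mult_left_mono)
next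
  case (Suc m)
  have "\<exists>h. (\<forall>x\<in>X. has_partial_within X i (\<lambda>x. c * f x) (h x) x) \<and> Cm_bdd m (\<bar>c\<bar> * B) X h" for i
  proof -
    obtain f' where "\<forall>x\<in>X. has_partial_within X i f (f' x) x" "Cm_bdd m B X f'"
      using Suc.prems by (auto dest!: spec[of _ i])
    then show ?thesis
      using Suc.IH unfolding has_partial_within_def
      by (intro exI[of _ "\<lambda>x. c * f' x"]) (auto intro: DERIV_cmult)
  qed
  then show ?case
    using Suc.prems by (auto simp: abs_mult intro: continuous_on_mult_left mult_left_mono)
qed

definition upd_coord :: "real^'d \<Rightarrow> 'd \<Rightarrow> real \<Rightarrow> real^'d" where
  "upd_coord x i t = (\<chi> j. if j = i then t else x $ j)"

lemma upd_coord_nth: "upd_coord x i t $ j = (if j = i then t else x $ j)"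
  by (simp add: upd_coord_def)

lemma upd_coord_triv [simp]: "upd_coord x i (x $ i) = x"
  by (simp add: vec_eq_iff upd_coord_nth)

lemma upd_coord_add_axis: "upd_coord x i t + s *\<^sub>R axis i 1 = upd_coord x i (t + s)"
  by (simp add: vec_eq_iff upd_coord_nth axis_def)

lemma has_partial_within_imp_derivative_line:
  assumes "has_partial_within X i f D (upd_coord x i t)"
  shows "((\<lambda>s. f (upd_coord x i s)) has_real_derivative D) (at t within {s. upd_coord x i s \<in> X})"
proof -
  have "(\<lambda>s. s - t) ` {s. upd_coord x i s \<in> X} = {s. upd_coord x i (t + s) \<in> X}"
    by (auto simp: image_iff intro!: exI[of _ "t + _"])
  then have "((\<lambda>s. f (upd_coord x i (t + s))) has_real_derivative D)
      (at (t - t) within (\<lambda>s. s - t) ` {s. upd_coord x i s \<in> X})"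
    using assms by (simp add: has_partial_within_def upd_coord_add_axis)
  then have "((\<lambda>s. f (upd_coord x i (t + s))) \<circ> (\<lambda>s. s - t) has_real_derivative D * 1)
      (at t within {s. upd_coord x i s \<in> X})"
    by (rule DERIV_image_chain) (auto intro!: derivative_eq_intros)
  then show ?thesis by (simp add: o_def)
qed

lemma Cm_bdd_imp_derivative_chain:
  assumes "Cm_bdd m B X f"
  obtains G where "G 0 = (\<lambda>t. f (upd_coord x i t))"
    "derivative_chain m G {t. upd_coord x i t \<in> X}"
    "\<And>t. upd_coord x i t \<in> X \<Longrightarrow> \<bar>G m t\<bar> \<le> B"
  using assms
proof (induction m arbitrary: f thesis)
  case 0
  show ?case
    by (rule "0.prems"(1)[of "\<lambda>_ t. f (upd_coord x i t)"])
      (use "0.prems"(2) in \<open>auto simp: derivative_chain_def\<close>)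
next
  case (Suc m)
  then obtain g where partial: "\<And>y. y \<in> X \<Longrightarrow> has_partial_within X i f (g y) y"
      and "Cm_bdd m B X g"
    by (metis Cm_bdd.simps(2))
  then obtain G where G_chain: "G 0 = (\<lambda>t. g (upd_coord x i t))"
      "derivative_chain m G {t. upd_coord x i t \<in> X}"
      "\<And>t. upd_coord x i t \<in> X \<Longrightarrow> \<bar>G m t\<bar> \<le> B"
    using Suc.IH by blast
  show ?case
  proof (rule Suc.prems(1))
    show "derivative_chain (Suc m) (case_nat (\<lambda>t. f (upd_coord x i t)) G) {t. upd_coord x i t \<in> X}"
      using G_chain(1,2) partial
      by (simp add: derivative_chain_Suc_iff has_partial_within_imp_derivative_line)
  qed (use G_chain(3) in auto)
qed

section \<open>The sampling inequality on the cube\<close>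

lemma upd_coord_in_cube_iff: "x \<in> cube \<Longrightarrow> upd_coord x i t \<in> cube \<longleftrightarrow> t \<in> {0..1}"
  by (auto simp: cube_def upd_coord_nth split: if_splits)

definition grid_coords :: "nat \<Rightarrow> real set" where
  "grid_coords k = (\<lambda>j. real j / real k) ` {..<k}"

definition grid :: "nat \<Rightarrow> (real^'d) set" where
  "grid k = {x. \<forall>i. x $ i \<in> grid_coords k}"

lemma grid_subset_cube: "grid k \<subseteq> cube"
proof -
  have "grid_coords k \<subseteq> {0..1}" by (auto simp: grid_coords_def)
  then show ?thesis by (auto simp: grid_def cube_def)
qed

lemma finite_grid: "finite (grid k :: (real^'d) set)"
  and card_grid_le: "card (grid k :: (real^'d) set) \<le> k ^ CARD('d)"
proof -
  let ?E = "PiE UNIV (\<lambda>_::'d. grid_coords k)"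
  have finite_tuples: "finite ?E" by (intro finite_PiE) (auto simp: grid_coords_def)
  have grid_eq: "(grid k :: (real^'d) set) = vec_lambda ` ?E"
  proof (intro equalityI subsetI)
    fix x :: "real^'d" assume "x \<in> grid k"
    then show "x \<in> vec_lambda ` ?E" by (intro image_eqI[of _ _ "vec_nth x"]) (auto simp: grid_def)
  qed (auto simp: grid_def PiE_iff)
  show "finite (grid k :: (real^'d) set)" using finite_tuples by (simp add: grid_eq)
  have "card (grid k :: (real^'d) set) \<le> card ?E"
    unfolding grid_eq by (rule card_image_le[OF finite_tuples])
  also have "\<dots> = card (grid_coords k) ^ CARD('d)" by (simp add: card_PiE)
  also have "\<dots> \<le> k ^ CARD('d)"
    using card_image_le[of "{..<k}" "\<lambda>j. real j / real k"]
    by (intro power_mono) (auto simp: grid_coords_def)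
  finally show "card (grid k :: (real^'d) set) \<le> k ^ CARD('d)" .
qed

lemma grid_window_exists:
  assumes "t \<in> {0..1}" "0 < q" "q \<le> k"
  obtains a where "a + q \<le> k" "t \<in> {real a / real k..real (a + q) / real k}"
proof -
  define a where "a = min (nat \<lfloor>t * real k\<rfloor>) (k - q)"
  have floor: "real (nat \<lfloor>t * real k\<rfloor>) \<le> t * real k" "t * real k < real (nat \<lfloor>t * real k\<rfloor>) + 1"
    using assms(1) by auto
  have "real a \<le> t * real k" using floor by (auto simp: a_def)
  moreover have "t * real k \<le> real (a + q)"
  proof (cases "nat \<lfloor>t * real k\<rfloor> \<le> k - q")
    case True
    then have "real a = real (nat \<lfloor>t * real k\<rfloor>)" by (simp add: a_def)
    moreover have "1 \<le> real q" using \<open>0 < q\<close> by simp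
    ultimately show ?thesis using floor(2) unfolding of_nat_add by linarith
  next
    case False
    then have "a + q = k" using \<open>q \<le> k\<close> by (simp add: a_def)
    moreover have "t * real k \<le> real k" using assms(1) by (simp add: mult_left_le_one_le)
    ultimately show ?thesis by simp
  qed
  ultimately have "t \<in> {real a / real k..real (a + q) / real k}"
    using assms(2,3) by (simp add: field_simps)
  moreover have "a + q \<le> k" using \<open>q \<le> k\<close> by (simp add: a_def)
  ultimately show thesis using that by blast
qed

lemma sampling_inequality_grid_line:
  assumes Cm_h: "Cm_bdd m B cube h" and x_cube: "x \<in> cube" and k_large: "2 ^ m \<le> k"
    and small: "\<And>t. t \<in> grid_coords k \<Longrightarrow> \<bar>h (upd_coord x i t)\<bar> \<le> \<epsilon>"
  shows "\<bar>h x\<bar> \<le> (3 * 2 ^ m) ^ m * (\<epsilon> + B / real k ^ m)"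
proof -
  have "k > 0" using k_large by (auto intro: Nat.gr0I)
  obtain G where G_0: "G 0 = (\<lambda>t. h (upd_coord x i t))"
      and chain: "derivative_chain m G {0..1}" and G_m_bound: "\<And>t. t \<in> {0..1} \<Longrightarrow> \<bar>G m t\<bar> \<le> B"
    using Cm_bdd_imp_derivative_chain[OF Cm_h, of x i]
    unfolding upd_coord_in_cube_iff[OF x_cube] by (metis Collect_mem_eq)
  have "x $ i \<in> {0..1}" using x_cube by (simp add: cube_def)
  then obtain a where a_le: "a + 2 ^ m \<le> k"
      and window: "x $ i \<in> {real a / real k..real (a + 2 ^ m) / real k}"
    using grid_window_exists[OF _ _ k_large] by auto
  let ?I = "{real a / real k..real (a + 2 ^ m) / real k}"
  have "real (a + 2 ^ m) / real k \<le> 1" using a_le \<open>k > 0\<close> by (simp del: of_nat_add)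
  then have window_sub: "?I \<subseteq> {0..1}" by (auto intro: order_trans[rotated])
  have "\<bar>G 0 (x $ i)\<bar> \<le> (3 * 2 ^ m) ^ m * (\<epsilon> + B * (1 / real k) ^ m)"
  proof (rule sampling_inequality_interval[OF _ _ _ _ _ _ _ window])
    show "derivative_chain m G ?I" using chain window_sub by (rule derivative_chain_subset)
    show "\<bar>G m t\<bar> \<le> B" if "t \<in> ?I" for t using G_m_bound window_sub that by blast
    show "separated (1 / real k) (2 ^ m) (\<lambda>j. real (a + j) / real k)"
      by (simp add: separated_def add_divide_distrib)
    fix j :: nat assume j_less: "j < 2 ^ m"
    then have "a + j < k" using a_le by simp
    then have "real (a + j) / real k \<in> grid_coords k" unfolding grid_coords_def by blast
    moreover have "real (a + j) / real k \<in> ?I"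
      using j_less by (simp add: divide_right_mono del: of_nat_add)
    ultimately show "real (a + j) / real k \<in> ?I \<and> \<bar>G 0 (real (a + j) / real k)\<bar> \<le> \<epsilon>"
      using small by (simp only: G_0)
  qed (use \<open>k > 0\<close> in \<open>auto simp: field_simps\<close>)
  then show ?thesis by (simp add: G_0 power_divide)
qed

lemma sampling_inequality_partial_grid:
  fixes S :: "'d::finite set"
  assumes Cm_h: "Cm_bdd m B cube h" and k_large: "2 ^ m \<le> k" and zero: "\<And>x. x \<in> grid k \<Longrightarrow> h x = 0"
    and "x \<in> cube" "\<And>i. i \<notin> S \<Longrightarrow> x $ i \<in> grid_coords k"
  shows "\<bar>h x\<bar> \<le> (2 * (3 * 2 ^ m) ^ m) ^ card S * (B / real k ^ m)"
  using finite[of S] assms(4-)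
proof (induction S arbitrary: x rule: finite_induct)
  case empty
  then have "x \<in> grid k" by (simp add: grid_def)
  moreover have "0 \<le> B" using Cm_bdd_abs_le[OF Cm_h \<open>x \<in> cube\<close>] by linarith
  ultimately show ?case using zero by simp
next
  case (insert i S)
  let ?A = "(3 * 2 ^ m) ^ m :: real"
  let ?C = "(2 * ?A) ^ card S" and ?\<delta> = "B / real k ^ m"
  have "0 \<le> ?\<delta>" using Cm_bdd_abs_le[OF Cm_h \<open>x \<in> cube\<close>] by simp
  have "1 \<le> ?A" by (intro one_le_power mult_ge1_I) auto
  then have "1 \<le> ?C" by (intro one_le_power) simp
  have "\<bar>h (upd_coord x i t)\<bar> \<le> ?C * ?\<delta>" if t_coord: "t \<in> grid_coords k" for t
  proof (rule insert.IH)
    have "t \<in> {0..1}" using t_coord by (auto simp: grid_coords_def)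
    then show "upd_coord x i t \<in> cube" by (simp add: upd_coord_in_cube_iff insert.prems(1))
    show "upd_coord x i t $ j \<in> grid_coords k" if "j \<notin> S" for j
      using t_coord insert.prems(2)[of j] that by (auto simp: upd_coord_nth)
  qed
  then have "\<bar>h x\<bar> \<le> ?A * (?C * ?\<delta> + ?\<delta>)"
    by (rule sampling_inequality_grid_line[OF Cm_h insert.prems(1) k_large])
  also have "\<dots> \<le> ?A * (?C * ?\<delta> + ?C * ?\<delta>)"
    using mult_right_mono[OF \<open>1 \<le> ?C\<close> \<open>0 \<le> ?\<delta>\<close>] by (intro mult_left_mono add_left_mono) auto
  also have "\<dots> = (2 * ?A) ^ card (insert i S) * ?\<delta>"
    using insert.hyps by (simp add: algebra_simps)
  finally show ?case .
qed

definition grid_const :: "'d::finite itself \<Rightarrow> nat \<Rightarrow> real" where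
  "grid_const _ m = (2 * (3 * 2 ^ m) ^ m) ^ CARD('d)"

lemma grid_const_pos: "0 < grid_const TYPE('d::finite) m"
  by (simp add: grid_const_def)

lemma sampling_inequality_grid:
  fixes h :: "real^'d \<Rightarrow> real"
  assumes Cm_h: "Cm_bdd m B cube h" and "1 \<le> k" and zero: "\<And>x. x \<in> grid k \<Longrightarrow> h x = 0"
    and x_cube: "x \<in> cube"
  shows "\<bar>h x\<bar> \<le> grid_const TYPE('d) m * (B / real k ^ m)"
proof (cases "2 ^ m \<le> k")
  case True
  from sampling_inequality_partial_grid[OF Cm_h this zero x_cube, of UNIV] show ?thesis
    by (simp add: grid_const_def)
next
  case False
  have h_le_B: "\<bar>h x\<bar> \<le> B" using Cm_h x_cube by (rule Cm_bdd_abs_le)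
  have "real k \<le> real (2 ^ m)" using False by (intro of_nat_mono) simp
  then have "real k \<le> 2 ^ m" by simp
  then have "real k ^ m \<le> (2 ^ m) ^ m" by (intro power_mono) auto
  also have "\<dots> \<le> (3 * 2 ^ m) ^ m" by (intro power_mono) auto
  also have "\<dots> \<le> 2 * (3 * 2 ^ m) ^ m" by simp
  also have "\<dots> \<le> grid_const TYPE('d) m"
    unfolding grid_const_def
  proof (rule self_le_power)
    have "(1 :: real) \<le> (3 * 2 ^ m) ^ m" by (intro one_le_power mult_ge1_I) auto
    then show "(1 :: real) \<le> 2 * (3 * 2 ^ m) ^ m" by linarith
  qed simp
  finally have "B * real k ^ m \<le> grid_const TYPE('d) m * B"
    using h_le_B by (subst mult.commute, intro mult_right_mono) auto
  then have "B \<le> grid_const TYPE('d) m * (B / real k ^ m)"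
    using \<open>1 \<le> k\<close> by (simp add: field_simps)
  with h_le_B show ?thesis by linarith
qed

definition rate :: "'d::finite itself \<Rightarrow> nat \<Rightarrow> real \<Rightarrow> nat \<Rightarrow> real" where
  "rate _ m B n = B * real n powr (- (real m / real CARD('d)))"

lemma rate_pos: "0 < B \<Longrightarrow> 1 \<le> n \<Longrightarrow> 0 < rate TYPE('d::finite) m B n"
  by (simp add: rate_def)

lemma rate_eq_root:
  assumes "1 \<le> n"
  shows "rate TYPE('d::finite) m B n = B / root CARD('d) (real n) ^ m"
proof -
  have "root CARD('d) (real n) ^ m = (real n powr (1 / real CARD('d))) powr real m"
    using assms by (simp add: powr_realpow root_powr_inverse)
  then show ?thesis by (simp add: rate_def powr_powr powr_minus_divide)
qed

definition sampling_const :: "'d::finite itself \<Rightarrow> nat \<Rightarrow> real" where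
  "sampling_const _ m = 2 ^ m * grid_const TYPE('d) m"

lemma sampling_const_pos: "0 < sampling_const TYPE('d::finite) m"
  by (simp add: sampling_const_def grid_const_pos)

lemma sampling_points_exist:
  assumes "1 \<le> n"
  obtains xs :: "(real^'d) list" where "length xs = n" "set xs \<subseteq> cube"
    "\<And>B h x. Cm_bdd m B cube h \<Longrightarrow> (\<And>y. y \<in> set xs \<Longrightarrow> h y = 0) \<Longrightarrow> x \<in> cube \<Longrightarrow>
       \<bar>h x\<bar> \<le> sampling_const TYPE('d) m * rate TYPE('d) m B n"
proof -
  let ?G = "grid :: nat \<Rightarrow> (real^'d) set"
  define r where "r = root CARD('d) (real n)"
  define k where "k = nat \<lfloor>r\<rfloor>"
  have "1 \<le> r" using assms by (simp add: r_def)
  then have "1 \<le> k" "real k \<le> r" "r < real k + 1" by (simp_all add: k_def le_nat_floor)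
  then have k_bounds: "1 \<le> k" "real k \<le> r" "r \<le> 2 * real k" by simp_all
  have "real (k ^ CARD('d)) \<le> r ^ CARD('d)" using k_bounds by (auto intro: power_mono)
  then have "k ^ CARD('d) \<le> n" by (simp add: r_def)
  then have card_le: "card (?G k) \<le> n" using card_grid_le[of k, where 'd = 'd] by linarith
  obtain ys where ys_grid: "set ys = ?G k" "length ys = card (?G k)"
    using finite_distinct_list[OF finite_grid] distinct_card by metis
  show thesis
  proof (rule that)
    let ?xs = "ys @ replicate (n - length ys) 0"
    show "length ?xs = n" using ys_grid card_le by simp
    show "set ?xs \<subseteq> cube" using ys_grid grid_subset_cube by auto
    fix B and h :: "real^'d \<Rightarrow> real" and x :: "real^'d"
    assume Cm_h: "Cm_bdd m B cube h" and zero: "\<And>y. y \<in> set ?xs \<Longrightarrow> h y = 0" and x_cube: "x \<in> cube"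
    have "0 \<le> B" using Cm_bdd_abs_le[OF Cm_h x_cube] by linarith
    have "\<bar>h x\<bar> \<le> grid_const TYPE('d) m * (B / real k ^ m)"
      using zero ys_grid by (intro sampling_inequality_grid[OF Cm_h \<open>1 \<le> k\<close> _ x_cube]) auto
    also have "B / real k ^ m \<le> 2 ^ m * rate TYPE('d) m B n"
    proof -
      have "r ^ m \<le> 2 ^ m * real k ^ m"
        using power_mono[OF k_bounds(3), of m] \<open>1 \<le> r\<close> by (simp add: power_mult_distrib)
      from mult_left_mono[OF this \<open>0 \<le> B\<close>] have "B * r ^ m \<le> 2 ^ m * B * real k ^ m"
        by (simp add: mult_ac)
      then show ?thesis
        using k_bounds(1) \<open>1 \<le> r\<close> by (simp add: rate_eq_root[OF assms] field_simps flip: r_def)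
    qed
    finally show "\<bar>h x\<bar> \<le> sampling_const TYPE('d) m * rate TYPE('d) m B n"
      using grid_const_pos[of m, where 'd = 'd] by (simp add: sampling_const_def mult_ac)
  qed
qed

section \<open>A polynomial bump on the unit interval\<close>

lemma has_real_derivative_zero_comparison:
  fixes f g :: "real \<Rightarrow> real"
  assumes "(f has_real_derivative 0) (at a)" "f a = 0" and g_le_f: "\<And>t. \<bar>g t\<bar> \<le> \<bar>f t\<bar>"
  shows "(g has_real_derivative 0) (at a)"
proof -
  have "((\<lambda>t. f t / (t - a)) \<longlongrightarrow> 0) (at a)"
    using assms(1,2) by (simp add: has_field_derivative_iff)
  then have "((\<lambda>t. g t / (t - a)) \<longlongrightarrow> 0) (at a)"
    by (rule tendsto_0_le[where K = 1])
      (use g_le_f in \<open>auto intro!: always_eventually divide_right_mono\<close>)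
  moreover have "g a = 0" using g_le_f[of a] \<open>f a = 0\<close> by simp
  ultimately show ?thesis by (simp add: has_field_derivative_iff)
qed

lemma has_real_derivative_cutoff:
  fixes f f' :: "real \<Rightarrow> real"
  assumes deriv: "\<And>t. (f has_real_derivative f' t) (at t)"
    and zero: "f a = 0" "f' a = 0" "f b = 0" "f' b = 0"
  shows "((\<lambda>t. if t \<in> {a..b} then f t else 0) has_real_derivative
           (if t \<in> {a..b} then f' t else 0)) (at t)"
proof -
  consider (inside) "t \<in> {a<..<b}" | (outside) "t \<in> - {a..b}" | (endpoint) "t = a \<or> t = b"
    by force
  then show ?thesis
  proof cases
    case inside
    have "((\<lambda>t. if t \<in> {a..b} then f t else 0) has_real_derivative f' t) (at t)"
      by (rule has_field_derivative_transform_within_open[OF deriv, of "{a<..<b}"])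
        (use inside in auto)
    then show ?thesis using inside by simp
  next
    case outside
    have "((\<lambda>t. if t \<in> {a..b} then f t else 0) has_real_derivative 0) (at t)"
      by (rule has_field_derivative_transform_within_open[of "\<lambda>_. 0" _ _ "- {a..b}"])
        (use outside in auto)
    moreover have "(if t \<in> {a..b} then f' t else 0) = 0" using outside by auto
    ultimately show ?thesis by (simp only:)
  next
    case endpoint
    then have "(f has_real_derivative 0) (at t)" "f t = 0" using deriv[of t] zero by auto
    then have "((\<lambda>t. if t \<in> {a..b} then f t else 0) has_real_derivative 0) (at t)"
      by (rule has_real_derivative_zero_comparison) auto
    moreover have "(if t \<in> {a..b} then f' t else 0) = 0" using endpoint zero by auto
    ultimately show ?thesis by (simp only:)
  qed
qed

lemma power_dvd_pderiv:
  fixes p q :: "'a::idom poly"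
  assumes "q ^ Suc k dvd p"
  shows "q ^ k dvd pderiv p"
proof -
  obtain r where "p = q ^ Suc k * r" using assms by (rule dvdE)
  then have "pderiv p = q ^ k * (q * pderiv r + smult (of_nat (Suc k)) (pderiv q * r))"
    by (simp add: pderiv_mult pderiv_power_Suc algebra_simps del: power_Suc flip: power_Suc)
  then show ?thesis by simp
qed

lemma power_dvd_funpow_pderiv:
  fixes p q :: "'a::idom poly"
  shows "q ^ (l + k) dvd p \<Longrightarrow> q ^ k dvd (pderiv ^^ l) p"
  by (induction l arbitrary: k) (auto intro: power_dvd_pderiv simp flip: power_Suc add_Suc_right)

text \<open>The exponent makes the derivatives up to order \<open>m + 1\<close> vanish at \<open>0\<close> and \<open>1\<close>.\<close>

definition bump_poly :: "nat \<Rightarrow> nat \<Rightarrow> real poly" where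
  "bump_poly m l = (pderiv ^^ l) ([:0, 1, -1:] ^ (m + 2))"

definition bump :: "nat \<Rightarrow> nat \<Rightarrow> real \<Rightarrow> real" where
  "bump m l t = (if t \<in> {0..1} then poly (bump_poly m l) t else 0)"

lemma poly_bump_poly_eq_0:
  assumes "l \<le> Suc m" "t = 0 \<or> t = 1"
  shows "poly (bump_poly m l) t = 0"
proof -
  have "[:0, 1, -1:] ^ (l + 1) dvd [:0, 1, -1:: real:] ^ (m + 2)"
    using assms(1) by (intro le_imp_power_dvd) simp
  then have "[:0, 1, -1:] ^ 1 dvd bump_poly m l"
    unfolding bump_poly_def by (rule power_dvd_funpow_pderiv)
  then obtain r where "bump_poly m l = [:0, 1, -1:] * r" by auto
  then show ?thesis using assms(2) by auto
qed

lemma has_real_derivative_bump: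
  assumes "l \<le> m"
  shows "(bump m l has_real_derivative bump m (Suc l) t) (at t)"
proof -
  have "bump_poly m (Suc l) = pderiv (bump_poly m l)" by (simp add: bump_poly_def)
  then have "(poly (bump_poly m l) has_real_derivative poly (bump_poly m (Suc l)) t) (at t)" for t
    by simp
  then show ?thesis
    unfolding bump_def[abs_def]
    by (rule has_real_derivative_cutoff) (use assms in \<open>auto intro: poly_bump_poly_eq_0\<close>)
qed

lemma continuous_on_bump: "l \<le> m \<Longrightarrow> continuous_on S (bump m l)"
  using has_real_derivative_bump
  by (blast intro: DERIV_continuous_on has_field_derivative_at_within)

lemma bump_eq_0: "t \<notin> {0..1} \<Longrightarrow> bump m l t = 0"
  by (auto simp: bump_def)

lemma bump_0: "bump m 0 t = (if t \<in> {0..1} then (t * (1 - t)) ^ (m + 2) else 0)"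
  by (simp add: bump_def bump_poly_def algebra_simps)

lemma bump_0_nonneg: "0 \<le> bump m 0 t"
  by (simp add: bump_0)

lemma bump_0_nonzeroD: "bump m 0 t \<noteq> 0 \<Longrightarrow> t \<in> {0<..<1}"
  by (cases "t = 0 \<or> t = 1") (auto simp: bump_0 split: if_splits)

lemma bump_0_ge:
  assumes "t \<in> {1/4..3/4}"
  shows "(3/16) ^ (m + 2) \<le> bump m 0 t"
proof -
  have "0 \<le> (t - 1/4) * (3/4 - t)" using assms by (intro mult_nonneg_nonneg) auto
  then have "3/16 \<le> t * (1 - t)" by (simp add: field_simps)
  then have "(3/16) ^ (m + 2) \<le> (t * (1 - t)) ^ (m + 2)" by (intro power_mono) auto
  then show ?thesis using assms by (simp add: bump_0)
qed

definition bump_norm :: "nat \<Rightarrow> real" where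
  "bump_norm m = (MAX l\<in>{..m}. SUP t\<in>{0..1}. \<bar>bump m l t\<bar>)"

lemma abs_bump_le:
  assumes "l \<le> m"
  shows "\<bar>bump m l t\<bar> \<le> bump_norm m"
proof -
  have on_unit: "\<bar>bump m l t\<bar> \<le> bump_norm m" if "t \<in> {0..1}" for t
  proof -
    have "bdd_above ((\<lambda>t. \<bar>bump m l t\<bar>) ` {0..1})"
      using assms by (intro bounded_imp_bdd_above compact_imp_bounded compact_continuous_image
        continuous_on_rabs continuous_on_bump) auto
    then have "\<bar>bump m l t\<bar> \<le> (SUP t\<in>{0..1}. \<bar>bump m l t\<bar>)" using that by (rule cSUP_upper[rotated])
    also have "\<dots> \<le> bump_norm m" unfolding bump_norm_def using assms by (intro Max_ge) auto
    finally show ?thesis .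
  qed
  show ?thesis
  proof (cases "t \<in> {0..1}")
    case False
    then show ?thesis using on_unit[of 0] by (simp add: bump_eq_0)
  qed (rule on_unit)
qed

lemma bump_norm_pos: "0 < bump_norm m"
proof -
  have "0 < (3/16 :: real) ^ (m + 2)" by simp
  also have "\<dots> \<le> bump m 0 (1/2)" by (rule bump_0_ge) simp
  also have "\<dots> \<le> bump_norm m" using abs_bump_le[of 0 m "1/2"] by simp
  finally show ?thesis .
qed

section \<open>Sums of bumps\<close>

text \<open>The partial derivative with multi-index \<open>\<alpha>\<close> of the bump in the cell with index \<open>c\<close> of the
  partition of the cube into \<open>K ^ d\<close> cells.\<close>

definition tensor_bump :: "nat \<Rightarrow> nat \<Rightarrow> ('d::finite \<Rightarrow> nat) \<Rightarrow> ('d \<Rightarrow> nat) \<Rightarrow> real^'d \<Rightarrow> real" where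
  "tensor_bump m K \<alpha> c x = (\<Prod>i\<in>UNIV. real K ^ \<alpha> i * bump m (\<alpha> i) (real K * x $ i - real (c i)))"

definition bump_field :: "nat \<Rightarrow> nat \<Rightarrow> ('d::finite \<Rightarrow> nat) \<Rightarrow> ('d \<Rightarrow> nat) set \<Rightarrow> real^'d \<Rightarrow> real" where
  "bump_field m K \<alpha> T x = (\<Sum>c\<in>T. tensor_bump m K \<alpha> c x)"

lemma has_partial_within_tensor_bump:
  assumes "\<alpha> i \<le> m"
  shows "has_partial_within X i (tensor_bump m K \<alpha> c) (tensor_bump m K (\<alpha>(i := Suc (\<alpha> i))) c x) x"
proof -
  let ?rest = "\<Prod>j\<in>UNIV - {i}. real K ^ \<alpha> j * bump m (\<alpha> j) (real K * x $ j - real (c j))"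
  have line: "tensor_bump m K \<alpha> c (x + t *\<^sub>R axis i 1) =
      real K ^ \<alpha> i * bump m (\<alpha> i) (real K * (x $ i + t) - real (c i)) * ?rest" for t
    unfolding tensor_bump_def by (subst prod.remove[of _ i]) (auto simp: axis_def intro!: prod.cong)
  have deriv: "tensor_bump m K (\<alpha>(i := Suc (\<alpha> i))) c x =
      real K ^ \<alpha> i * (bump m (Suc (\<alpha> i)) (real K * (x $ i + 0) - real (c i)) * real K) * ?rest"
    unfolding tensor_bump_def by (subst prod.remove[of _ i]) (auto intro!: prod.cong)
  have "((\<lambda>t. bump m (\<alpha> i) (real K * (x $ i + t) - real (c i))) has_real_derivative
      bump m (Suc (\<alpha> i)) (real K * (x $ i + 0) - real (c i)) * real K) (at 0)"
    by (rule DERIV_chain2[OF has_real_derivative_bump[OF assms]])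
      (auto intro!: derivative_eq_intros)
  from DERIV_cmult_right[OF DERIV_cmult[OF this]] show ?thesis
    unfolding has_partial_within_def line deriv by (rule has_field_derivative_at_within)
qed

lemma has_partial_within_bump_field:
  assumes "\<alpha> i \<le> m"
  shows "has_partial_within X i (bump_field m K \<alpha> T) (bump_field m K (\<alpha>(i := Suc (\<alpha> i))) T x) x"
  using has_partial_within_tensor_bump[of \<alpha> i, OF assms]
  unfolding has_partial_within_def bump_field_def by (intro DERIV_sum)

lemma continuous_on_tensor_bump:
  assumes "\<And>i. \<alpha> i \<le> m"
  shows "continuous_on X (tensor_bump m K \<alpha> c)"
proof -
  have "continuous_on X (\<lambda>x. bump m (\<alpha> i) (real K * x $ i - real (c i)))" for i
  proof (rule continuous_on_compose2[of UNIV "bump m (\<alpha> i)"])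
    show "continuous_on X (\<lambda>x. real K * x $ i - real (c i))" by (intro continuous_intros)
  qed (use assms in \<open>auto intro: continuous_on_bump\<close>)
  then show ?thesis
    unfolding tensor_bump_def by (intro continuous_on_prod continuous_on_mult_left)
qed

lemma sum_translates_le:
  fixes b :: "real \<Rightarrow> real"
  assumes "\<And>t. \<bar>b t\<bar> \<le> M" and supp: "\<And>t. t \<notin> {0..1} \<Longrightarrow> b t = 0"
  shows "(\<Sum>j<K. \<bar>b (s - real j)\<bar>) \<le> 2 * M"
proof -
  let ?J = "{nat \<lfloor>s\<rfloor>, nat \<lfloor>s\<rfloor> - 1}"
  have "0 \<le> M" using assms(1)[of 0] by linarith
  have "b (s - real j) = 0" if "j \<notin> ?J" for j
  proof (rule supp)
    show "s - real j \<notin> {0..1}" using that by (auto simp: le_floor_iff nat_eq_iff) linarith+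
  qed
  then have "(\<Sum>j<K. \<bar>b (s - real j)\<bar>) = (\<Sum>j\<in>{..<K} \<inter> ?J. \<bar>b (s - real j)\<bar>)"
    by (intro sum.mono_neutral_right) auto
  also have "\<dots> \<le> (\<Sum>j\<in>?J. \<bar>b (s - real j)\<bar>)" by (intro sum_mono2) auto
  also have "\<dots> \<le> real (card ?J) * M" using assms(1) by (intro sum_bounded_above) auto
  also have "\<dots> \<le> 2 * M" using \<open>0 \<le> M\<close> by (intro mult_right_mono) (auto simp: card_insert_if)
  finally show ?thesis .
qed

lemma abs_bump_field_le:
  fixes T :: "('d::finite \<Rightarrow> nat) set"
  assumes T_sub: "T \<subseteq> PiE UNIV (\<lambda>_. {..<K})" and order: "sum \<alpha> UNIV \<le> m" and "1 \<le> K"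
  shows "\<bar>bump_field m K \<alpha> T x\<bar> \<le> real K ^ m * (2 * bump_norm m) ^ CARD('d)"
proof -
  have \<alpha>_le: "\<alpha> i \<le> m" for i using order member_le_sum[of i UNIV \<alpha>] by auto
  have abs_eq: "\<bar>tensor_bump m K \<alpha> c x\<bar> =
      real K ^ sum \<alpha> UNIV * (\<Prod>i\<in>UNIV. \<bar>bump m (\<alpha> i) (real K * x $ i - real (c i))\<bar>)" for c
    by (simp add: tensor_bump_def abs_prod abs_mult prod.distrib power_sum)
  have "\<bar>bump_field m K \<alpha> T x\<bar> \<le> (\<Sum>c\<in>T. \<bar>tensor_bump m K \<alpha> c x\<bar>)"
    unfolding bump_field_def by (rule sum_abs)
  also have "\<dots> \<le> (\<Sum>c\<in>PiE UNIV (\<lambda>_. {..<K}). \<bar>tensor_bump m K \<alpha> c x\<bar>)"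
    using T_sub by (intro sum_mono2 finite_PiE) auto
  also have "\<dots> = real K ^ sum \<alpha> UNIV *
      (\<Prod>i\<in>UNIV. \<Sum>j<K. \<bar>bump m (\<alpha> i) (real K * x $ i - real j)\<bar>)"
    unfolding abs_eq sum_distrib_left[symmetric] by (subst prod_sum_PiE) auto
  also have "\<dots> \<le> real K ^ m * (\<Prod>i\<in>(UNIV::'d set). 2 * bump_norm m)"
    using order \<open>1 \<le> K\<close> \<alpha>_le
    by (intro mult_mono power_increasing prod_mono conjI sum_translates_le sum_nonneg prod_nonneg)
       (auto intro: abs_bump_le bump_eq_0)
  finally show ?thesis by simp
qed

lemma Cm_bdd_bump_field:
  fixes T :: "('d::finite \<Rightarrow> nat) set"
  assumes T_sub: "T \<subseteq> PiE UNIV (\<lambda>_. {..<K})" and K_pos: "1 \<le> K"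
  shows "k + sum \<alpha> UNIV \<le> m \<Longrightarrow>
    Cm_bdd k (real K ^ m * (2 * bump_norm m) ^ CARD('d)) X (bump_field m K \<alpha> T)"
proof (induction k arbitrary: \<alpha>)
  case 0
  then have "\<alpha> i \<le> m" for i using member_le_sum[of i UNIV \<alpha>] by auto
  then have "continuous_on X (bump_field m K \<alpha> T)"
    unfolding bump_field_def[abs_def] by (intro continuous_on_sum continuous_on_tensor_bump)
  then show ?case using 0 abs_bump_field_le[OF T_sub _ K_pos] by simp
next
  case (Suc k)
  let ?B = "real K ^ m * (2 * bump_norm m) ^ CARD('d)"
  have "Cm_bdd k ?B X (bump_field m K \<alpha> T)" using Suc by auto
  moreover have "\<exists>g. (\<forall>x\<in>X. has_partial_within X i (bump_field m K \<alpha> T) (g x) x) \<and> Cm_bdd k ?B X g"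
    for i
  proof (intro exI conjI ballI)
    have "\<alpha> i \<le> m" using Suc.prems member_le_sum[of i UNIV \<alpha>] by auto
    then show "has_partial_within X i (bump_field m K \<alpha> T)
        (bump_field m K (\<alpha>(i := Suc (\<alpha> i))) T x) x" for x
      by (rule has_partial_within_bump_field)
    have "sum (\<alpha>(i := Suc (\<alpha> i))) UNIV = Suc (sum \<alpha> UNIV)" by (simp add: sum.remove[of UNIV i])
    then show "Cm_bdd k ?B X (bump_field m K (\<alpha>(i := Suc (\<alpha> i))) T)"
      using Suc.prems by (intro Suc.IH) auto
  qed
  ultimately show ?case by (auto dest: Cm_bdd_abs_le Cm_bdd_imp_continuous_on)
qed

section \<open>Fooling functions\<close>

lemma set_integral_ge_const_on_subset:
  fixes f :: "'a \<Rightarrow> real"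
  assumes f_nonneg: "set_integrable M A f" "\<And>x. x \<in> A \<Longrightarrow> 0 \<le> f x"
    and E_sub: "E \<in> sets M" "emeasure M E < \<infinity>" "E \<subseteq> A" "\<And>x. x \<in> E \<Longrightarrow> c \<le> f x"
  shows "c * measure M E \<le> (LINT x:A|M. f x)"
proof -
  have "c * measure M E = (LINT x|M. c * indicator E x)"
    using E_sub sets.sets_into_space[of E M] by (simp add: Int_absorb2)
  also have "\<dots> \<le> (LINT x|M. indicator A x *\<^sub>R f x)"
  proof (rule integral_mono)
    show "integrable M (\<lambda>x. c * indicator E x)"
      using E_sub by (intro integrable_mult_right integrable_real_indicator) auto
  qed (use f_nonneg E_sub in \<open>auto simp: set_integrable_def indicator_def\<close>)
  finally show ?thesis by (simp add: set_lebesgue_integral_def)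
qed

definition cell_core :: "nat \<Rightarrow> ('d \<Rightarrow> nat) \<Rightarrow> (real^'d) set" where
  "cell_core K c = cbox (\<chi> i. (real (c i) + 1/4) / real K) (\<chi> i. (real (c i) + 3/4) / real K)"

lemma cell_core_coordinate:
  "0 < K \<Longrightarrow> x \<in> cell_core K c \<Longrightarrow> real K * x $ i - real (c i) \<in> {1/4..3/4}"
  by (simp add: cell_core_def mem_box_cart field_simps)

lemma cell_core_subset_cube:
  assumes "\<And>i. c i < K"
  shows "cell_core K c \<subseteq> cube"
proof
  fix x assume x_core: "x \<in> cell_core K c"
  have "0 \<le> x $ i \<and> x $ i \<le> 1" for i
  proof -
    have "0 < K" "real (c i) + 1 \<le> real K" using assms[of i] by linarith+
    then have "0 \<le> real K * x $ i" "real K * x $ i \<le> real K"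
      using cell_core_coordinate[OF \<open>0 < K\<close> x_core, of i] unfolding atLeastAtMost_iff by linarith+
    then show ?thesis using \<open>0 < K\<close> by (simp add: zero_le_mult_iff)
  qed
  then show "x \<in> cube" by (simp add: cube_def)
qed

lemma measure_cell_core:
  assumes "0 < K"
  shows "measure lborel (cell_core K c :: (real^'d) set) = (1 / (2 * real K)) ^ CARD('d)"
proof -
  let ?l = "(\<chi> i. (real (c i) + 1/4) / real K) :: real^'d"
  let ?u = "(\<chi> i. (real (c i) + 3/4) / real K) :: real^'d"
  have "measure lborel (cbox ?l ?u) = (\<Prod>i\<in>UNIV. ?u $ i - ?l $ i)"
    by (rule content_cbox_cart) (simp add: interval_ne_empty_cart divide_right_mono)
  also have "\<dots> = (\<Prod>i\<in>(UNIV::'d set). 1 / (2 * real K))"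
    using assms by (intro prod.cong) (auto simp: field_simps)
  finally show ?thesis by (simp add: cell_core_def)
qed

lemma set_integral_tensor_bump_ge:
  fixes c :: "'d::finite \<Rightarrow> nat"
  assumes c_less: "\<And>i. c i < K"
  shows "((3/16) ^ (m + 2) / (2 * real K)) ^ CARD('d)
      \<le> (LINT x:cube|lborel. tensor_bump m K (\<lambda>_. 0) c x)"
proof -
  have "0 < K" using c_less[of undefined] by simp
  have ge_on_core: "((3/16) ^ (m + 2)) ^ CARD('d) \<le> tensor_bump m K (\<lambda>_. 0) c x"
    if "x \<in> cell_core K c" for x
  proof -
    have "(\<Prod>i\<in>(UNIV::'d set). (3/16) ^ (m + 2)) \<le> (\<Prod>i\<in>UNIV. bump m 0 (real K * x $ i - real (c i)))"
      using cell_core_coordinate[OF \<open>0 < K\<close> that] by (intro prod_mono conjI bump_0_ge) auto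
    then show ?thesis by (simp add: tensor_bump_def)
  qed
  have "((3/16) ^ (m + 2) / (2 * real K)) ^ CARD('d) =
      ((3/16) ^ (m + 2)) ^ CARD('d) * measure lborel (cell_core K c :: (real^'d) set)"
    by (simp only: measure_cell_core[OF \<open>0 < K\<close>] power_mult_distrib[symmetric]
      times_divide_eq_right mult_1_right)
  also have "\<dots> \<le> (LINT x:cube|lborel. tensor_bump m K (\<lambda>_. 0) c x)"
  proof (rule set_integral_ge_const_on_subset)
    show "set_integrable lborel cube (tensor_bump m K (\<lambda>_. 0) c)"
      by (intro set_integrable_cube continuous_on_tensor_bump) simp
    show "0 \<le> tensor_bump m K (\<lambda>_. 0) c x" for x
      by (simp add: tensor_bump_def bump_0_nonneg prod_nonneg)
    show "emeasure lborel (cell_core K c :: (real^'d) set) < \<infinity>"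
      by (simp add: cell_core_def emeasure_lborel_cbox_eq)
    show "cell_core K c \<subseteq> cube" using c_less by (rule cell_core_subset_cube)
    show "cell_core K c \<in> sets lborel" by (simp add: cell_core_def)
  qed (rule ge_on_core)
  finally show ?thesis .
qed

definition cell_index :: "nat \<Rightarrow> real^'d \<Rightarrow> 'd \<Rightarrow> nat" where
  "cell_index K x = (\<lambda>i. nat \<lfloor>real K * x $ i\<rfloor>)"

lemma tensor_bump_eq_0:
  assumes "c \<noteq> cell_index K x"
  shows "tensor_bump m K (\<lambda>_. 0) c x = 0"
proof (rule ccontr)
  assume "tensor_bump m K (\<lambda>_. 0) c x \<noteq> 0"
  then have "bump m 0 (real K * x $ i - real (c i)) \<noteq> 0" for i by (simp add: tensor_bump_def)
  then have "real K * x $ i - real (c i) \<in> {0<..<1}" for i by (rule bump_0_nonzeroD)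
  then have "\<lfloor>real K * x $ i\<rfloor> = int (c i)" for i
    unfolding floor_eq_iff by (auto simp: algebra_simps less_imp_le)
  then show False using assms by (simp add: cell_index_def)
qed

definition right_half :: "'d \<Rightarrow> (real^'d) set" where
  "right_half i = {x. x $ i > 1/2}"

definition half_cells :: "'d \<Rightarrow> nat \<Rightarrow> ('d \<Rightarrow> nat) set" where
  "half_cells i k = PiE UNIV (\<lambda>j. if j = i then {..<k} else {..<2 * k})"

lemma half_cells_subset: "half_cells i k \<subseteq> PiE UNIV (\<lambda>_. {..<2 * k})"
  unfolding half_cells_def by (rule PiE_mono) auto

lemma card_half_cells: "2 * card (half_cells (i :: 'd::finite) k) = (2 * k) ^ CARD('d)"
proof -
  have "card (half_cells i k) = (\<Prod>j\<in>UNIV. if j = i then k else 2 * k)"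
    unfolding half_cells_def by (subst card_PiE) (auto intro: prod.cong)
  also have "\<dots> = k * (2 * k) ^ (CARD('d) - 1)" by (subst prod.remove[of _ i]) auto
  finally show ?thesis by (simp add: power_eq_if[of _ "CARD('d)"])
qed

lemma cell_index_right_half_notin:
  assumes "x \<in> right_half i"
  shows "cell_index (2 * k) x \<notin> half_cells i k"
proof
  assume "cell_index (2 * k) x \<in> half_cells i k"
  then have "nat \<lfloor>real (2 * k) * x $ i\<rfloor> < k"
    unfolding half_cells_def cell_index_def by (auto simp: PiE_iff dest: spec[of _ i])
  moreover have "real k \<le> real (2 * k) * x $ i"
    using assms mult_left_mono[of "1/2" "x $ i" "real (2 * k)"] by (simp add: right_half_def)
  then have "k \<le> nat \<lfloor>real (2 * k) * x $ i\<rfloor>" by (rule le_nat_floor)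
  ultimately show False by linarith
qed

lemma card_free_half_cells:
  fixes pts :: "(real^'d) set"
  assumes "finite pts" and "4 * card pts \<le> (2 * k) ^ CARD('d)"
  shows "real (2 * k) ^ CARD('d) / 4 \<le> real (card (half_cells i k - cell_index (2 * k) ` pts))"
proof -
  let ?used = "cell_index (2 * k) ` pts"
  have "card (half_cells i k) \<le> card (half_cells i k - ?used) + card ?used"
    using diff_card_le_card_Diff[of ?used "half_cells i k"] assms(1) by (simp add: le_diff_conv)
  also have "card ?used \<le> card pts" using assms(1) by (rule card_image_le)
  finally have "(2 * k) ^ CARD('d) \<le> 4 * card (half_cells i k - ?used)"
    using assms(2) card_half_cells[of i k] by linarith
  then have "real ((2 * k) ^ CARD('d)) \<le> real (4 * card (half_cells i k - ?used))"
    by (rule of_nat_mono)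
  then show ?thesis by simp
qed

lemma set_integral_bump_field_ge:
  fixes T :: "('d::finite \<Rightarrow> nat) set"
  assumes "T \<subseteq> PiE UNIV (\<lambda>_. {..<K})"
  shows "real (card T) * ((3/16) ^ (m + 2) / (2 * real K)) ^ CARD('d)
     \<le> (LINT x:cube|lborel. bump_field m K (\<lambda>_. 0) T x)"
proof -
  have "real (card T) * ((3/16) ^ (m + 2) / (2 * real K)) ^ CARD('d)
      \<le> (\<Sum>c\<in>T. LINT x:cube|lborel. tensor_bump m K (\<lambda>_. 0) c x)"
    using assms by (intro sum_bounded_below set_integral_tensor_bump_ge) (auto simp: PiE_iff)
  also have "\<dots> = (LINT x:cube|lborel. bump_field m K (\<lambda>_. 0) T x)"
    unfolding bump_field_def set_lebesgue_integral_def scaleR_sum_right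
    by (intro Bochner_Integration.integral_sum[symmetric]
      set_integrable_cube[unfolded set_integrable_def] continuous_on_tensor_bump) simp
  finally show ?thesis .
qed

definition cell_const :: "'d::finite itself \<Rightarrow> nat \<Rightarrow> real" where
  "cell_const _ m = ((3/16) ^ (m + 2) / (4 * bump_norm m)) ^ CARD('d) / 4"

lemma cell_const_mult_eq:
  assumes "1 \<le> K"
  shows "cell_const TYPE('d::finite) m * (B / real K ^ m) =
    B / (real K ^ m * (2 * bump_norm m) ^ CARD('d)) *
      (real K ^ CARD('d) / 4 * ((3/16) ^ (m + 2) / (2 * real K)) ^ CARD('d))"
proof -
  let ?d = "CARD('d)"
  define \<beta> :: real where "\<beta> = (3/16) ^ (m + 2)"
  have "real K ^ ?d * (\<beta> / (2 * real K)) ^ ?d = (\<beta> / 2) ^ ?d"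
    using assms by (simp flip: power_mult_distrib)
  moreover have "(\<beta> / (4 * bump_norm m)) ^ ?d = (\<beta> / 2) ^ ?d / (2 * bump_norm m) ^ ?d"
    by (simp only: power_divide[symmetric] divide_divide_eq_left mult.assoc) simp
  ultimately show ?thesis
    by (simp only: cell_const_def \<beta>_def[symmetric] times_divide_eq_left times_divide_eq_right
        divide_divide_eq_left times_divide_times_eq mult_ac)
qed

lemma fooling_function_cells:
  fixes pts :: "(real^'d) set"
  assumes "0 < B" "1 \<le> k" "finite pts" "4 * card pts \<le> (2 * k) ^ CARD('d)"
  obtains f where "Cm_bdd m B cube f" "\<And>x. x \<in> pts \<union> right_half i \<Longrightarrow> f x = 0"
    "cell_const TYPE('d) m * (B / real (2 * k) ^ m) \<le> (LINT x:cube|lborel. f x)"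
proof -
  let ?d = "CARD('d)" and ?K = "2 * k" and ?M = "bump_norm m"
  let ?T = "half_cells i k - cell_index ?K ` pts"
  define H where "H = B / (real ?K ^ m * (2 * ?M) ^ ?d)"
  define f where "f x = H * bump_field m ?K (\<lambda>_. 0) ?T x" for x :: "real^'d"
  have "0 < H" using assms(1,2) bump_norm_pos[of m] by (simp add: H_def)
  have T_sub: "?T \<subseteq> PiE UNIV (\<lambda>_. {..<?K})" using half_cells_subset[of i k] by blast
  show thesis
  proof (rule that)
    have "Cm_bdd m (\<bar>H\<bar> * (real ?K ^ m * (2 * ?M) ^ ?d)) cube f"
      unfolding f_def using T_sub assms(2) by (intro Cm_bdd_cmult Cm_bdd_bump_field) auto
    also have "\<bar>H\<bar> * (real ?K ^ m * (2 * ?M) ^ ?d) = B"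
      using assms(1,2) bump_norm_pos[of m] by (simp add: H_def abs_mult)
    finally show "Cm_bdd m B cube f" .
    fix x assume "x \<in> pts \<union> right_half i"
    then have "cell_index ?K x \<notin> ?T" using cell_index_right_half_notin by blast
    then have "tensor_bump m ?K (\<lambda>_. 0) c x = 0" if "c \<in> ?T" for c
      using that by (metis tensor_bump_eq_0)
    then show "f x = 0" by (simp add: f_def bump_field_def)
  next
    have "cell_const TYPE('d) m * (B / real ?K ^ m) =
        H * (real ?K ^ ?d / 4 * ((3/16) ^ (m + 2) / (2 * real ?K)) ^ ?d)"
      unfolding H_def using assms(2) by (intro cell_const_mult_eq) simp
    also have "\<dots> \<le> H * (real (card ?T) * ((3/16) ^ (m + 2) / (2 * real ?K)) ^ ?d)"
      using \<open>0 < H\<close> card_free_half_cells[OF assms(3,4)]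
      by (intro mult_left_mono mult_right_mono) auto
    also have "\<dots> \<le> H * (LINT x:cube|lborel. bump_field m ?K (\<lambda>_. 0) ?T x)"
      using \<open>0 < H\<close> T_sub by (intro mult_left_mono set_integral_bump_field_ge) auto
    also have "\<dots> = (LINT x:cube|lborel. f x)" by (simp add: f_def)
    finally show "cell_const TYPE('d) m * (B / real ?K ^ m) \<le> (LINT x:cube|lborel. f x)" .
  qed
qed

definition fooling_const :: "'d::finite itself \<Rightarrow> nat \<Rightarrow> real" where
  "fooling_const _ m = cell_const TYPE('d) m / 8 ^ m"

lemma fooling_const_pos: "0 < fooling_const TYPE('d::finite) m"
  by (simp add: fooling_const_def cell_const_def bump_norm_pos)

lemma fooling_function_exists:
  fixes pts :: "(real^'d) set"
  assumes "0 < B" "1 \<le> n" "finite pts" "card pts \<le> n"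
  obtains f where "Cm_bdd m B cube f" "\<And>x. x \<in> pts \<union> right_half i \<Longrightarrow> f x = 0"
    "fooling_const TYPE('d) m * rate TYPE('d) m B n \<le> (LINT x:cube|lborel. f x)"
proof -
  let ?d = "CARD('d)"
  define r where "r = root ?d (real n)"
  define k where "k = 2 * nat \<lceil>r\<rceil>"
  have "1 \<le> r" using assms(2) by (simp add: r_def)
  then have k_bounds: "1 \<le> k" "4 * r \<le> real (2 * k)" "real (2 * k) \<le> 8 * r"
    unfolding k_def by simp_all linarith+
  have "4 * real n \<le> 4 ^ ?d * real n"
    using self_le_power[of "4::real" ?d] by (intro mult_right_mono) auto
  also have "\<dots> = (4 * r) ^ ?d" by (simp add: power_mult_distrib r_def)
  also have "\<dots> \<le> real (2 * k) ^ ?d" using k_bounds \<open>1 \<le> r\<close> by (intro power_mono) auto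
  finally have "real (4 * n) \<le> real ((2 * k) ^ ?d)" by simp
  then have "4 * card pts \<le> (2 * k) ^ ?d" using assms(4) by linarith
  then obtain f where fooling: "Cm_bdd m B cube f" "\<And>x. x \<in> pts \<union> right_half i \<Longrightarrow> f x = 0"
      "cell_const TYPE('d) m * (B / real (2 * k) ^ m) \<le> (LINT x:cube|lborel. f x)"
    using fooling_function_cells[OF assms(1) k_bounds(1) assms(3)] by blast
  have "fooling_const TYPE('d) m * rate TYPE('d) m B n = cell_const TYPE('d) m * (B / (8 * r) ^ m)"
    by (simp add: fooling_const_def rate_eq_root[OF assms(2)] power_mult_distrib flip: r_def)
  also have "\<dots> \<le> cell_const TYPE('d) m * (B / real (2 * k) ^ m)"
  proof (rule mult_left_mono)
    have "0 < real (2 * k)" using k_bounds(1) by simp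
    then show "B / (8 * r) ^ m \<le> B / real (2 * k) ^ m"
      using assms(1) \<open>1 \<le> r\<close> k_bounds(3)
      by (intro divide_left_mono power_mono mult_pos_pos zero_less_power) linarith+
    show "0 \<le> cell_const TYPE('d) m" by (simp add: cell_const_def bump_norm_pos less_imp_le)
  qed
  also note fooling(3)
  finally show thesis using fooling that by blast
qed

section \<open>Normalising constants\<close>

lemma set_integrable_exp_cube:
  fixes f :: "real^'d \<Rightarrow> real"
  shows "continuous_on cube f \<Longrightarrow> set_integrable lborel cube (\<lambda>x. exp (f x))"
  by (intro set_integrable_cube continuous_intros)

lemma set_integral_const_cube: "(LINT x:(cube :: (real^'d) set)|lborel. c) = (c :: real)"
  by (simp add: set_lebesgue_integral_def measure_lborel_cube)

lemma Zf_zero: "Zf (\<lambda>_ :: real^'d. 0) = 1"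
  by (simp add: Zf_def set_integral_const_cube)

lemma exp_set_integral_le_Zf:
  fixes f :: "real^'d \<Rightarrow> real"
  assumes "continuous_on cube f"
  shows "exp (LINT x:cube|lborel. f x) \<le> Zf f"
proof -
  let ?a = "LINT x:cube|lborel. f x"
  note int = set_integrable_cube[OF assms] set_integrable_exp_cube[OF assms]
  have const: "set_integrable lborel (cube :: (real^'d) set) (\<lambda>_. c :: real)" for c
    by (rule set_integrable_cube) simp
  have "exp ?a = exp ?a * (?a + (1 - ?a))" by simp
  also have "\<dots> = (LINT x:cube|lborel. exp ?a * (f x + (1 - ?a)))"
    by (simp only: set_integral_mult_right set_integral_add(2)[OF int(1) const]
      set_integral_const_cube)
  also have "\<dots> \<le> (LINT x:cube|lborel. exp (f x))"
  proof (rule set_integral_mono)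
    fix x :: "real^'d"
    have "f x + (1 - ?a) \<le> exp (f x - ?a)" using exp_ge_add_one_self[of "f x - ?a"] by linarith
    then have "exp ?a * (f x + (1 - ?a)) \<le> exp ?a * exp (f x - ?a)" by (intro mult_left_mono) auto
    then show "exp ?a * (f x + (1 - ?a)) \<le> exp (f x)" by (simp flip: exp_add)
  qed (use int const in auto)
  finally show ?thesis by (simp add: Zf_def)
qed

lemma Zf_pos: "continuous_on cube f \<Longrightarrow> 0 < Zf f"
  using exp_set_integral_le_Zf[of f] by (rule less_le_trans[OF exp_gt_zero])

definition uniformly_close :: "real \<Rightarrow> (real^'d \<Rightarrow> real) \<Rightarrow> (real^'d \<Rightarrow> real) \<Rightarrow> bool" where
  "uniformly_close \<delta> f g \<longleftrightarrow>
     continuous_on cube f \<and> continuous_on cube g \<and> (\<forall>x\<in>cube. \<bar>f x - g x\<bar> \<le> \<delta>)"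

lemma uniformly_close_sym: "uniformly_close \<delta> f g \<Longrightarrow> uniformly_close \<delta> g f"
  by (simp add: uniformly_close_def abs_minus_commute)

lemma uniformly_close_imp_continuous_on:
  assumes "uniformly_close \<delta> f g"
  shows "continuous_on cube f" "continuous_on cube g"
  using assms by (auto simp: uniformly_close_def)

lemma uniformly_close_abs_le: "uniformly_close \<delta> f g \<Longrightarrow> x \<in> cube \<Longrightarrow> \<bar>f x - g x\<bar> \<le> \<delta>"
  by (simp add: uniformly_close_def)

lemma Lf_le_add:
  assumes "uniformly_close \<delta> f g"
  shows "Lf f \<le> Lf g + \<delta>"
proof -
  note cont = uniformly_close_imp_continuous_on[OF assms]
  have "f x \<le> g x + \<delta>" if "x \<in> cube" for x
    using uniformly_close_abs_le[OF assms that] by linarith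
  then have "Zf f \<le> (LINT x:cube|lborel. exp (g x) * exp \<delta>)"
    unfolding Zf_def
    by (intro set_integral_mono set_integrable_mult_left set_integrable_exp_cube cont)
      (simp flip: exp_add)
  also have "\<dots> = Zf g * exp \<delta>" by (simp add: Zf_def)
  finally have "ln (Zf f) \<le> ln (Zf g * exp \<delta>)" using Zf_pos[OF cont(1)] by (rule ln_mono)
  then show ?thesis using Zf_pos[OF cont(2)] by (simp add: Lf_def ln_mult)
qed

lemma abs_Lf_diff_le: "uniformly_close \<delta> f g \<Longrightarrow> \<bar>Lf f - Lf g\<bar> \<le> \<delta>"
  using Lf_le_add[of \<delta> f g] Lf_le_add[OF uniformly_close_sym, of \<delta> f g] by linarith

section \<open>Densities on the cube\<close>

lemma Dists_iff: "M \<in> Dists \<longleftrightarrow> M \<in> space (prob_algebra borel) \<and> emeasure M cube = 1"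
  by (auto simp: Dists_def space_prob_algebra)

lemma sets_Dists: "M \<in> Dists \<Longrightarrow> sets M = sets borel"
  by (simp add: Dists_def)

lemma prob_space_Dists: "M \<in> Dists \<Longrightarrow> prob_space M"
  by (simp add: Dists_def)

lemma abs_measure_diff_le_one:
  assumes "P \<in> Dists" "Q \<in> Dists"
  shows "\<bar>measure P A - measure Q A\<bar> \<le> 1"
proof -
  have "0 \<le> measure M A \<and> measure M A \<le> 1" if "M \<in> Dists" for M :: "(real^'a) measure"
    using prob_space.prob_le_1[OF prob_space_Dists[OF that]] by simp
  from this[OF assms(1)] this[OF assms(2)] show ?thesis by linarith
qed

lemma AE_Dists_in_cube:
  assumes "M \<in> Dists"
  shows "AE x in M. x \<in> cube"
proof -
  interpret prob_space M using assms by (rule prob_space_Dists)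
  show ?thesis using assms by (intro AE_prob_1) (simp add: Dists_def measure_def)
qed

lemma density_lborel_in_Dists:
  fixes \<rho> :: "real^'d \<Rightarrow> real"
  assumes density: "integrable lborel \<rho>" "\<And>x. 0 \<le> \<rho> x" "integral\<^sup>L lborel \<rho> = 1"
      "\<And>x. x \<notin> cube \<Longrightarrow> \<rho> x = 0"
  shows "density lborel (\<lambda>x. ennreal (\<rho> x)) \<in> Dists"
proof -
  have mass: "emeasure (density lborel (\<lambda>x. ennreal (\<rho> x))) A = 1"
    if "A \<in> sets borel" "cube \<subseteq> A" for A
  proof -
    have "emeasure (density lborel (\<lambda>x. ennreal (\<rho> x))) A
        = (\<integral>\<^sup>+x. ennreal (\<rho> x) * indicator A x \<partial>lborel)"
      using density(1) that by (intro emeasure_density) auto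
    also have "\<dots> = (\<integral>\<^sup>+x. ennreal (\<rho> x) \<partial>lborel)"
    proof (rule nn_integral_cong)
      have "\<rho> x = 0" if "x \<notin> A" for x using density(4) \<open>cube \<subseteq> A\<close> that by blast
      then show "ennreal (\<rho> x) * indicator A x = ennreal (\<rho> x)" for x by (simp add: indicator_def)
    qed
    also have "\<dots> = 1" using density by (subst nn_integral_eq_integral) auto
    finally show ?thesis .
  qed
  from mass[of UNIV] mass[OF sets_borel_cube] show ?thesis
    by (auto simp: Dists_def intro: prob_spaceI)
qed

definition pdf :: "(real^'d \<Rightarrow> real) \<Rightarrow> real^'d \<Rightarrow> real" where
  "pdf f x = indicator cube x * exp (f x) / Zf f"

lemma pdf_outside: "x \<notin> cube \<Longrightarrow> pdf f x = 0"
  by (simp add: pdf_def)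

lemma pdf_eq_exp: "continuous_on cube f \<Longrightarrow> x \<in> cube \<Longrightarrow> pdf f x = exp (f x - Lf f)"
  using Zf_pos[of f] by (simp add: pdf_def Lf_def exp_diff)

lemma pdf_nonneg: "continuous_on cube f \<Longrightarrow> 0 \<le> pdf f x"
  using Zf_pos[of f] by (simp add: pdf_def)

lemma integrable_pdf: "continuous_on cube f \<Longrightarrow> integrable lborel (pdf f)"
  using set_integrable_exp_cube[of f] unfolding set_integrable_def pdf_def[abs_def] by simp

lemma borel_measurable_pdf: "continuous_on cube f \<Longrightarrow> pdf f \<in> borel_measurable borel"
  using borel_measurable_integrable[OF integrable_pdf] by simp

lemma integral_pdf: "continuous_on cube f \<Longrightarrow> integral\<^sup>L lborel (pdf f) = 1"
  using Zf_pos[of f] unfolding pdf_def[abs_def] by (simp add: Zf_def set_lebesgue_integral_def)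

lemma Pf_eq_density: "Pf f = density lborel (\<lambda>x. ennreal (pdf f x))"
  by (simp add: Pf_def pdf_def)

lemma Pf_in_Dists: "continuous_on cube f \<Longrightarrow> Pf f \<in> Dists"
  unfolding Pf_eq_density
  by (intro density_lborel_in_Dists integrable_pdf integral_pdf pdf_nonneg pdf_outside)

lemma pdf_ratio_ge:
  assumes "uniformly_close \<delta> f g"
  shows "exp (- (2 * \<delta>)) * pdf g x \<le> pdf f x"
proof (cases "x \<in> cube")
  case True
  have "\<bar>f x - g x\<bar> \<le> \<delta>" using assms True by (rule uniformly_close_abs_le)
  then have "- (2 * \<delta>) + (g x - Lf g) \<le> f x - Lf f" using abs_Lf_diff_le[OF assms] by linarith
  then show ?thesis
    using uniformly_close_imp_continuous_on[OF assms] True by (simp add: pdf_eq_exp flip: exp_add)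
qed (simp add: pdf_outside)

section \<open>Mixtures and upper bounds for the distances\<close>

definition mixture :: "real \<Rightarrow> 'a measure \<Rightarrow> 'a measure \<Rightarrow> 'a measure" where
  "mixture c M N = measure_pmf (bernoulli_pmf c) \<bind> (\<lambda>b. if b then M else N)"

lemma mixture_kernel_measurable:
  assumes "M \<in> space (prob_algebra K)" "N \<in> space (prob_algebra K)"
  shows "(\<lambda>b. if b then M else N) \<in> measurable (measure_pmf p) (prob_algebra K)"
  using assms by simp

lemma mixture_in_prob_algebra:
  assumes "M \<in> space (prob_algebra K)" "N \<in> space (prob_algebra K)"
  shows "mixture c M N \<in> space (prob_algebra K)"
proof -
  have "measure_pmf (bernoulli_pmf c) \<in> space (prob_algebra (measure_pmf (bernoulli_pmf c)))"
    by (simp add: space_prob_algebra prob_space_measure_pmf)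
  note sets_bind'[OF this mixture_kernel_measurable[OF assms]]
    prob_space_bind'[OF this mixture_kernel_measurable[OF assms]]
  then show ?thesis by (simp add: mixture_def space_prob_algebra)
qed

lemma nn_integral_mixture:
  assumes components: "M \<in> space (prob_algebra K)" "N \<in> space (prob_algebra K)"
    and weight: "0 \<le> c" "c \<le> 1"
    and u_meas: "u \<in> borel_measurable K"
  shows "(\<integral>\<^sup>+x. u x \<partial>mixture c M N) = ennreal c * (\<integral>\<^sup>+x. u x \<partial>M) + ennreal (1 - c) * (\<integral>\<^sup>+x. u x \<partial>N)"
  unfolding mixture_def
  using weight
    nn_integral_bind[OF u_meas measurable_prob_algebraD[OF mixture_kernel_measurable[OF components]]]
  by (simp add: mult.commute)

lemma emeasure_mixture:
  assumes components: "M \<in> space (prob_algebra K)" "N \<in> space (prob_algebra K)"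
    and weight: "0 \<le> c" "c \<le> 1"
    and A_sets: "A \<in> sets K"
  shows "emeasure (mixture c M N) A = ennreal c * emeasure M A + ennreal (1 - c) * emeasure N A"
proof -
  have "sets M = sets K" "sets N = sets K" "sets (mixture c M N) = sets K"
    using components mixture_in_prob_algebra[OF components] by (auto simp: space_prob_algebra)
  then show ?thesis using nn_integral_mixture[OF components weight, of "indicator A"] A_sets by simp
qed

lemma measure_mixture:
  assumes components: "M \<in> space (prob_algebra K)" "N \<in> space (prob_algebra K)"
    and weight: "0 \<le> c" "c \<le> 1"
    and "A \<in> sets K"
  shows "measure (mixture c M N) A = c * measure M A + (1 - c) * measure N A"
proof -
  interpret M: prob_space M using components by (simp add: space_prob_algebra)
  interpret N: prob_space N using components by (simp add: space_prob_algebra)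
  have "emeasure (mixture c M N) A = ennreal (c * measure M A + (1 - c) * measure N A)"
    unfolding emeasure_mixture[OF assms] M.emeasure_eq_measure N.emeasure_eq_measure
    using weight by (simp flip: ennreal_mult ennreal_plus)
  then show ?thesis using weight by (intro measure_eq_emeasure_eq_ennreal) auto
qed

lemma distr_mixture:
  assumes components: "M \<in> space (prob_algebra K)" "N \<in> space (prob_algebra K)"
    and "f \<in> measurable K L"
  shows "distr (mixture c M N) L f = mixture c (distr M L f) (distr N L f)"
proof -
  have "distr (mixture c M N) L f =
      measure_pmf (bernoulli_pmf c) \<bind> (\<lambda>b. distr (if b then M else N) L f)"
    unfolding mixture_def
    using measurable_prob_algebraD[OF mixture_kernel_measurable[OF components]] assms(3)
    by (intro distr_bind) auto
  also have "\<dots> = mixture c (distr M L f) (distr N L f)"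
    unfolding mixture_def by (rule arg_cong[of _ _ "bind _"]) auto
  finally show ?thesis .
qed

lemma mixture_same: "prob_space M \<Longrightarrow> mixture c M M = M"
  by (simp add: mixture_def bind_const' prob_space_measure_pmf prob_space_imp_subprob_space)

lemma density_convex_combination_eq_mixture:
  fixes p q :: "'a \<Rightarrow> real"
  assumes [measurable]: "p \<in> borel_measurable M" "q \<in> borel_measurable M"
    and nonneg: "\<And>x. 0 \<le> p x" "\<And>x. 0 \<le> q x" and weight: "0 \<le> c" "c \<le> 1"
    and prob: "prob_space (density M p)" "prob_space (density M q)"
  shows "density M (\<lambda>x. ennreal (c * p x + (1 - c) * q x)) = mixture c (density M p) (density M q)"
proof (rule measure_eqI)
  have components: "density M p \<in> space (prob_algebra M)" "density M q \<in> space (prob_algebra M)"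
    using prob by (simp_all add: space_prob_algebra)
  show "sets (density M (\<lambda>x. ennreal (c * p x + (1 - c) * q x)))
      = sets (mixture c (density M p) (density M q))"
    using mixture_in_prob_algebra[OF components] by (simp add: space_prob_algebra)
  fix A assume "A \<in> sets (density M (\<lambda>x. ennreal (c * p x + (1 - c) * q x)))"
  then have A_sets [measurable]: "A \<in> sets M" by simp
  have "emeasure (density M (\<lambda>x. ennreal (c * p x + (1 - c) * q x))) A =
      (\<integral>\<^sup>+x. ennreal c * (ennreal (p x) * indicator A x) +
             ennreal (1 - c) * (ennreal (q x) * indicator A x) \<partial>M)"
    using weight nonneg
    by (subst emeasure_density) (auto simp: ennreal_mult indicator_def intro!: nn_integral_cong)
  also have "\<dots> = ennreal c * emeasure (density M p) A + ennreal (1 - c) * emeasure (density M q) A"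
    by (simp add: nn_integral_add nn_integral_cmult emeasure_density)
  also have "\<dots> = emeasure (mixture c (density M p) (density M q)) A"
    using components weight A_sets by (rule emeasure_mixture[symmetric])
  finally show "emeasure (density M (\<lambda>x. ennreal (c * p x + (1 - c) * q x))) A =
      emeasure (mixture c (density M p) (density M q)) A" .
qed

lemma Pf_eq_mixture:
  assumes "uniformly_close \<delta> f g" "0 < \<delta>"
  obtains R where "R \<in> Dists" "Pf f = mixture (exp (- (2 * \<delta>))) (Pf g) R"
proof -
  define c where "c = exp (- (2 * \<delta>))"
  have weight: "0 < c" "c < 1" using \<open>0 < \<delta>\<close> by (auto simp: c_def)
  note cont = uniformly_close_imp_continuous_on[OF assms(1)]
  define \<rho> where "\<rho> = (\<lambda>x. (pdf f x - c * pdf g x) / (1 - c))"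
  have int_\<rho>: "integrable lborel \<rho>" unfolding \<rho>_def using cont by (simp add: integrable_pdf)
  have \<rho>_nonneg: "0 \<le> \<rho> x" for x
    using pdf_ratio_ge[OF assms(1)] weight by (simp add: \<rho>_def flip: c_def)
  have R_Dists: "density lborel \<rho> \<in> Dists"
  proof (rule density_lborel_in_Dists[OF int_\<rho> \<rho>_nonneg])
    show "integral\<^sup>L lborel \<rho> = 1"
      using weight cont by (simp add: \<rho>_def integrable_pdf integral_pdf)
    show "\<rho> x = 0" if "x \<notin> cube" for x using that by (simp add: \<rho>_def pdf_outside)
  qed
  have "Pf f = density lborel (\<lambda>x. ennreal (c * pdf g x + (1 - c) * \<rho> x))"
    using weight by (simp add: Pf_eq_density \<rho>_def)
  also have "\<dots> = mixture c (Pf g) (density lborel \<rho>)"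
    unfolding Pf_eq_density
  proof (rule density_convex_combination_eq_mixture)
    show "prob_space (density lborel (pdf g))"
      using prob_space_Dists[OF Pf_in_Dists[OF cont(2)]] by (simp add: Pf_eq_density)
  qed (use weight cont int_\<rho> \<rho>_nonneg R_Dists in
        \<open>simp_all add: borel_measurable_pdf pdf_nonneg prob_space_Dists\<close>)
  finally show thesis using R_Dists that by (simp add: c_def)
qed

lemma tv_dist_mixture_le:
  assumes QR_Dists: "Q \<in> Dists" "R \<in> Dists" and weight: "0 \<le> c" "c \<le> 1"
  shows "tv_dist (mixture c Q R) Q \<le> ereal (1 - c)"
proof -
  have "\<bar>measure (mixture c Q R) A - measure Q A\<bar> \<le> 1 - c" if "A \<in> sets borel" for A
  proof -
    have "measure (mixture c Q R) A - measure Q A = (1 - c) * (measure R A - measure Q A)"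
      using measure_mixture[OF _ _ weight that] QR_Dists by (simp add: Dists_iff algebra_simps)
    then show ?thesis
      using abs_measure_diff_le_one[OF QR_Dists(2,1)] weight by (simp add: abs_mult mult_left_le)
  qed
  then show ?thesis unfolding tv_dist_def by (auto intro: cSUP_least)
qed

lemma norm_diff_cube_le:
  fixes x y :: "real^'d"
  assumes "x \<in> cube" "y \<in> cube"
  shows "norm (x - y) \<le> real CARD('d)"
proof -
  have "norm (x - y) \<le> (\<Sum>i\<in>UNIV. \<bar>(x - y) $ i\<bar>)" by (rule norm_le_l1_cart)
  also have "\<dots> \<le> (\<Sum>i\<in>(UNIV::'d set). 1)"
  proof (rule sum_mono)
    fix i
    have "0 \<le> x $ i" "x $ i \<le> 1" "0 \<le> y $ i" "y $ i \<le> 1" using assms by (auto simp: cube_def)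
    then show "\<bar>(x - y) $ i\<bar> \<le> 1" by simp
  qed
  finally show ?thesis by simp
qed

lemma borel_measurable_fst [measurable]:
  "fst \<in> borel_measurable (borel :: ('a::topological_space \<times> 'b::topological_space) measure)"
  by (intro borel_measurable_continuous_onI continuous_on_fst continuous_on_id)

lemma borel_measurable_snd [measurable]:
  "snd \<in> borel_measurable (borel :: ('a::topological_space \<times> 'b::topological_space) measure)"
  by (intro borel_measurable_continuous_onI continuous_on_snd continuous_on_id)

lemma (in pair_prob_space) distr_pair_snd: "distr (M1 \<Otimes>\<^sub>M M2) M2 snd = M2"
proof -
  have "distr (M1 \<Otimes>\<^sub>M M2) M2 snd = distr (M2 \<Otimes>\<^sub>M M1) M2 (snd \<circ> (\<lambda>(x, y). (y, x)))"
    by (subst distr_pair_swap, subst distr_distr) auto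
  also have "snd \<circ> (\<lambda>(x, y). (y, x)) = (fst :: 'b \<times> 'a \<Rightarrow> 'b)" by auto
  finally show ?thesis by (simp add: M1.distr_pair_fst)
qed

lemma nn_integral_norm_diff_pair_le:
  fixes P Q :: "(real^'d) measure"
  assumes "P \<in> Dists" "Q \<in> Dists"
  shows "(\<integral>\<^sup>+z. ennreal (norm (fst z - snd z)) \<partial>(P \<Otimes>\<^sub>M Q)) \<le> ennreal (real CARD('d))"
proof -
  interpret P: prob_space P using assms(1) by (rule prob_space_Dists)
  interpret Q: prob_space Q using assms(2) by (rule prob_space_Dists)
  interpret PQ: pair_prob_space P Q ..
  have "AE x in distr (P \<Otimes>\<^sub>M Q) P fst. x \<in> cube"
    unfolding Q.distr_pair_fst using assms(1) by (rule AE_Dists_in_cube)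
  from AE_distrD[OF measurable_fst this] have "AE z in P \<Otimes>\<^sub>M Q. fst z \<in> cube" .
  moreover have "AE x in distr (P \<Otimes>\<^sub>M Q) Q snd. x \<in> cube"
    unfolding PQ.distr_pair_snd using assms(2) by (rule AE_Dists_in_cube)
  from AE_distrD[OF measurable_snd this] have "AE z in P \<Otimes>\<^sub>M Q. snd z \<in> cube" .
  ultimately have "AE z in P \<Otimes>\<^sub>M Q. ennreal (norm (fst z - snd z)) \<le> ennreal (real CARD('d))"
    by eventually_elim (intro ennreal_leI norm_diff_cube_le)
  then have "(\<integral>\<^sup>+z. ennreal (norm (fst z - snd z)) \<partial>(P \<Otimes>\<^sub>M Q))
      \<le> (\<integral>\<^sup>+z. ennreal (real CARD('d)) \<partial>(P \<Otimes>\<^sub>M Q))"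
    by (rule nn_integral_mono_AE)
  then show ?thesis by (simp add: PQ.emeasure_space_1)
qed

lemma distr_diag_in_prob_algebra:
  fixes Q :: "(real^'d) measure"
  assumes "Q \<in> Dists"
  shows "distr Q borel (\<lambda>x. (x, x)) \<in> space (prob_algebra borel)"
proof -
  interpret Q: prob_space Q using assms by (rule prob_space_Dists)
  note [measurable_cong] = sets_Dists[OF assms]
  show ?thesis by (simp add: space_prob_algebra Q.prob_space_distr)
qed

lemma pair_measure_in_prob_algebra:
  fixes P Q :: "(real^'d) measure"
  assumes "P \<in> Dists" "Q \<in> Dists"
  shows "P \<Otimes>\<^sub>M Q \<in> space (prob_algebra borel)"
proof -
  have "sets (P \<Otimes>\<^sub>M Q) = sets (borel :: ((real^'d) \<times> (real^'d)) measure)"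
    using sets_pair_measure_cong[OF sets_Dists[OF assms(1)] sets_Dists[OF assms(2)]]
    by (simp only: borel_prod)
  then show ?thesis
    using assms by (simp add: space_prob_algebra prob_space_pair prob_space_Dists)
qed

lemma mixture_diag_pair_in_couplings:
  fixes Q R :: "(real^'d) measure"
  assumes "Q \<in> Dists" "R \<in> Dists"
  shows "mixture c (distr Q borel (\<lambda>x. (x, x))) (R \<Otimes>\<^sub>M Q) \<in> couplings (mixture c Q R) Q"
    (is "mixture c ?diag ?indep \<in> _")
proof -
  interpret Q: prob_space Q using assms(1) by (rule prob_space_Dists)
  interpret R: prob_space R using assms(2) by (rule prob_space_Dists)
  interpret RQ: pair_prob_space R Q ..
  note sets [measurable_cong] = sets_Dists[OF assms(1)] sets_Dists[OF assms(2)]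
  note components = distr_diag_in_prob_algebra[OF assms(1)] pair_measure_in_prob_algebra[OF assms(2,1)]
  have diag_marginals: "distr ?diag borel fst = Q" "distr ?diag borel snd = Q"
    by (simp_all add: distr_distr o_def distr_id2 sets)
  have indep_marginals: "distr ?indep borel fst = R" "distr ?indep borel snd = Q"
    using Q.distr_pair_fst[of R] RQ.distr_pair_snd sets by (simp_all cong: distr_cong)
  have "distr (mixture c ?diag ?indep) borel fst = mixture c Q R"
    unfolding distr_mixture[OF components borel_measurable_fst] diag_marginals indep_marginals ..
  moreover have "distr (mixture c ?diag ?indep) borel snd = Q"
    unfolding distr_mixture[OF components borel_measurable_snd] diag_marginals indep_marginals
    by (rule mixture_same) (rule Q.prob_space_axioms)
  ultimately show ?thesis
    using mixture_in_prob_algebra[OF components] by (simp add: couplings_def space_prob_algebra)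
qed

lemma w1_dist_mixture_le:
  fixes Q R :: "(real^'d) measure"
  assumes QR_Dists: "Q \<in> Dists" "R \<in> Dists" and weight: "0 \<le> c" "c \<le> 1"
  shows "w1_dist (mixture c Q R) Q \<le> ereal ((1 - c) * real CARD('d))"
proof -
  note [measurable_cong] = sets_Dists[OF QR_Dists(1)]
  note components =
    distr_diag_in_prob_algebra[OF QR_Dists(1)] pair_measure_in_prob_algebra[OF QR_Dists(2,1)]
  have "(INF \<pi>\<in>couplings (mixture c Q R) Q. \<integral>\<^sup>+z. ennreal (norm (fst z - snd z)) \<partial>\<pi>)
      \<le> (\<integral>\<^sup>+z. ennreal (norm (fst z - snd z)) \<partial>mixture c (distr Q borel (\<lambda>x. (x, x))) (R \<Otimes>\<^sub>M Q))"
    using QR_Dists by (intro INF_lower mixture_diag_pair_in_couplings)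
  also have "\<dots> = ennreal (1 - c) * (\<integral>\<^sup>+z. ennreal (norm (fst z - snd z)) \<partial>(R \<Otimes>\<^sub>M Q))"
    by (subst nn_integral_mixture[OF components weight]) (auto simp: nn_integral_distr)
  also have "\<dots> \<le> ennreal (1 - c) * ennreal (real CARD('d))"
    by (intro mult_left_mono nn_integral_norm_diff_pair_le QR_Dists) simp
  also have "\<dots> = ennreal ((1 - c) * real CARD('d))" using weight by (simp flip: ennreal_mult)
  finally have "w1_dist (mixture c Q R) Q \<le> enn2ereal (ennreal ((1 - c) * real CARD('d)))"
    unfolding w1_dist_def by (simp add: less_eq_ennreal.rep_eq)
  then show ?thesis using weight by simp
qed

lemma one_minus_exp_le: "1 - exp (- (2 * \<delta>)) \<le> 2 * min 1 (\<delta> :: real)"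
  using exp_ge_add_one_self[of "- (2 * \<delta>)"] exp_gt_zero[of "- (2 * \<delta>)"] by linarith

lemma tv_dist_Pf_le:
  assumes "uniformly_close \<delta> f g" "0 < \<delta>"
  shows "tv_dist (Pf f) (Pf g) \<le> ereal (2 * min 1 \<delta>)"
proof -
  note Pf_g = Pf_in_Dists[OF uniformly_close_imp_continuous_on(2)[OF assms(1)]]
  obtain R where mix: "R \<in> Dists" "Pf f = mixture (exp (- (2 * \<delta>))) (Pf g) R"
    using assms by (rule Pf_eq_mixture)
  have "tv_dist (Pf f) (Pf g) \<le> ereal (1 - exp (- (2 * \<delta>)))"
    unfolding mix(2) using assms(2) by (intro tv_dist_mixture_le Pf_g mix(1)) auto
  also have "\<dots> \<le> ereal (2 * min 1 \<delta>)" using one_minus_exp_le by simp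
  finally show ?thesis .
qed

lemma w1_dist_Pf_le:
  fixes f g :: "real^'d \<Rightarrow> real"
  assumes "uniformly_close \<delta> f g" "0 < \<delta>"
  shows "w1_dist (Pf f) (Pf g) \<le> ereal (2 * real CARD('d) * min 1 \<delta>)"
proof -
  note Pf_g = Pf_in_Dists[OF uniformly_close_imp_continuous_on(2)[OF assms(1)]]
  obtain R where mix: "R \<in> Dists" "Pf f = mixture (exp (- (2 * \<delta>))) (Pf g) R"
    using assms by (rule Pf_eq_mixture)
  have "w1_dist (Pf f) (Pf g) \<le> ereal ((1 - exp (- (2 * \<delta>))) * real CARD('d))"
    unfolding mix(2) using assms(2) by (intro w1_dist_mixture_le Pf_g mix(1)) auto
  also have "\<dots> \<le> ereal (2 * real CARD('d) * min 1 \<delta>)"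
    using mult_right_mono[OF one_minus_exp_le, of "real CARD('d)" \<delta>] by (simp add: mult_ac)
  finally show ?thesis .
qed

lemma Pf_eq_density_Pf:
  assumes "continuous_on cube f" "continuous_on cube g"
  shows "Pf f = density (Pf g) (\<lambda>x. ennreal (pdf f x / pdf g x))"
proof -
  note [measurable] = borel_measurable_pdf[OF assms(1)] borel_measurable_pdf[OF assms(2)]
  have "pdf g x * (pdf f x / pdf g x) = pdf f x" for x
    using pdf_eq_exp[OF assms(2), of x] pdf_outside[of x f] by (cases "x \<in> cube") auto
  then have "ennreal (pdf g x) * ennreal (pdf f x / pdf g x) = ennreal (pdf f x)" for x
    using pdf_nonneg[OF assms(1), of x] pdf_nonneg[OF assms(2), of x]
    by (subst ennreal_mult[symmetric]) (simp_all only: divide_nonneg_nonneg)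
  then show ?thesis unfolding Pf_eq_density by (subst density_density_eq) auto
qed

lemma absolutely_continuous_Pf:
  assumes "continuous_on cube f" "continuous_on cube g"
  shows "absolutely_continuous (Pf g) (Pf f)"
proof -
  note [measurable] = borel_measurable_pdf[OF assms(1)] borel_measurable_pdf[OF assms(2)]
  show ?thesis
    unfolding Pf_eq_density_Pf[OF assms]
    by (intro absolutely_continuousI_density) (simp add: Pf_def)
qed

lemma AE_RN_deriv_Pf:
  assumes "continuous_on cube f" "continuous_on cube g"
  shows "AE x in Pf g. x \<in> cube \<and>
    RN_deriv (Pf g) (Pf f) x = ennreal (exp ((f x - Lf f) - (g x - Lf g)))"
proof -
  note [measurable] = borel_measurable_pdf[OF assms(1)] borel_measurable_pdf[OF assms(2)]
  interpret prob_space "Pf g" using assms(2) by (intro prob_space_Dists Pf_in_Dists)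
  have "AE x in Pf g. ennreal (pdf f x / pdf g x) = RN_deriv (Pf g) (Pf f) x"
    using assms by (intro RN_deriv_unique Pf_eq_density_Pf[symmetric]) (simp_all add: Pf_def)
  moreover have "AE x in Pf g. x \<in> cube" using assms(2) by (intro AE_Dists_in_cube Pf_in_Dists)
  ultimately show ?thesis
    by eventually_elim (use assms in \<open>simp add: pdf_eq_exp exp_diff\<close>)
qed

lemma suplog_dist_Pf_le:
  assumes "uniformly_close \<delta> f g"
  shows "suplog_dist (Pf f) (Pf g) \<le> ereal (2 * \<delta>)"
proof -
  note cont = uniformly_close_imp_continuous_on[OF assms]
  have "AE x in Pf g. ereal \<bar>ln (enn2real (RN_deriv (Pf g) (Pf f) x))\<bar> \<le> ereal (2 * \<delta>)"
    using AE_RN_deriv_Pf[OF cont]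
  proof eventually_elim
    case (elim x)
    then have "\<bar>f x - g x\<bar> \<le> \<delta>" using uniformly_close_abs_le[OF assms] by blast
    then have "\<bar>(f x - Lf f) - (g x - Lf g)\<bar> \<le> 2 * \<delta>" using abs_Lf_diff_le[OF assms] by linarith
    then show ?case using elim by simp
  qed
  then show ?thesis
    unfolding suplog_dist_def using absolutely_continuous_Pf cont by (auto intro!: esssup_I)
qed

section \<open>Lower bounds for the distances\<close>

lemma tv_dist_ge:
  assumes "P \<in> Dists" "Q \<in> Dists" "A \<in> sets borel"
  shows "ereal \<bar>measure P A - measure Q A\<bar> \<le> tv_dist P Q"
  unfolding tv_dist_def using abs_measure_diff_le_one[OF assms(1,2)] assms(3)
  by (auto intro!: cSUP_upper bdd_aboveI2)

lemma integral_diff_le_transport_cost: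
  fixes u :: "real^'d \<Rightarrow> real"
  assumes lip: "1-lipschitz_on UNIV u" and bdd: "bounded (range u)"
    and coupling: "\<pi> \<in> couplings P Q"
  shows "ennreal \<bar>(LINT x|P. u x) - (LINT x|Q. u x)\<bar> \<le> (\<integral>\<^sup>+z. ennreal (norm (fst z - snd z)) \<partial>\<pi>)"
proof -
  have u_meas [measurable]: "u \<in> borel_measurable borel"
    using lipschitz_on_continuous_on[OF lip] by (rule borel_measurable_continuous_onI)
  obtain M where u_bound: "\<bar>u x\<bar> \<le> M" for x using bdd by (auto simp: bounded_iff)
  have sets [measurable_cong]: "sets \<pi> = sets borel"
    and marginals: "P = distr \<pi> borel fst" "Q = distr \<pi> borel snd"
    using coupling by (auto simp: couplings_def)
  interpret prob_space \<pi> using coupling by (simp add: couplings_def)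
  have u_integrable: "integrable \<pi> (\<lambda>z. u (fst z))" "integrable \<pi> (\<lambda>z. u (snd z))"
    using u_bound by (auto intro!: integrable_const_bound[of _ M])
  have "(LINT x|P. u x) - (LINT x|Q. u x) = (LINT z|\<pi>. u (fst z) - u (snd z))"
    unfolding marginals using u_integrable by (simp add: integral_distr)
  then have "\<bar>(LINT x|P. u x) - (LINT x|Q. u x)\<bar> \<le> (LINT z|\<pi>. \<bar>u (fst z) - u (snd z)\<bar>)"
    using integral_abs_bound[of \<pi> "\<lambda>z. u (fst z) - u (snd z)"] by simp
  then have "ennreal \<bar>(LINT x|P. u x) - (LINT x|Q. u x)\<bar>
      \<le> ennreal (LINT z|\<pi>. \<bar>u (fst z) - u (snd z)\<bar>)"
    by (rule ennreal_leI)
  also have "\<dots> = (\<integral>\<^sup>+z. ennreal \<bar>u (fst z) - u (snd z)\<bar> \<partial>\<pi>)"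
    using u_integrable
    by (intro nn_integral_eq_integral[symmetric] integrable_abs Bochner_Integration.integrable_diff)
       auto
  also have "\<dots> \<le> (\<integral>\<^sup>+z. ennreal (norm (fst z - snd z)) \<partial>\<pi>)"
    using lipschitz_onD[OF lip] by (intro nn_integral_mono ennreal_leI) (simp add: dist_norm)
  finally show ?thesis .
qed

lemma w1_dist_ge:
  fixes u :: "real^'d \<Rightarrow> real"
  assumes "1-lipschitz_on UNIV u" "bounded (range u)"
  shows "ereal \<bar>(LINT x|P. u x) - (LINT x|Q. u x)\<bar> \<le> w1_dist P Q"
proof -
  have "ennreal \<bar>(LINT x|P. u x) - (LINT x|Q. u x)\<bar>
      \<le> (INF \<pi>\<in>couplings P Q. \<integral>\<^sup>+z. ennreal (norm (fst z - snd z)) \<partial>\<pi>)"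
    using assms by (intro INF_greatest integral_diff_le_transport_cost)
  then have "enn2ereal (ennreal \<bar>(LINT x|P. u x) - (LINT x|Q. u x)\<bar>) \<le> w1_dist P Q"
    unfolding w1_dist_def by (simp only: less_eq_ennreal.rep_eq)
  then show ?thesis by simp
qed

lemma suplog_dist_le_imp_absolutely_continuous:
  assumes "suplog_dist P Q \<le> ereal \<epsilon>"
  shows "absolutely_continuous P Q" "absolutely_continuous Q P"
  using assms by (auto simp: suplog_dist_def split: if_splits)

lemma suplog_dist_le_imp_RN_deriv_bounds:
  assumes PQ_Dists: "P \<in> Dists" "Q \<in> Dists" and dist_le: "suplog_dist P Q \<le> ereal \<epsilon>"
  shows "AE x in Q. ennreal (exp (- \<epsilon>)) \<le> RN_deriv Q P x \<and> RN_deriv Q P x \<le> ennreal (exp \<epsilon>)"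
proof -
  interpret P: prob_space P using PQ_Dists(1) by (rule prob_space_Dists)
  interpret Q: prob_space Q using PQ_Dists(2) by (rule prob_space_Dists)
  have sets: "sets P = sets Q" using PQ_Dists by (simp add: sets_Dists)
  note ac = suplog_dist_le_imp_absolutely_continuous[OF dist_le]
  let ?r = "RN_deriv Q P"
  have sup_le: "esssup Q (\<lambda>x. ereal \<bar>ln (enn2real (?r x))\<bar>) \<le> ereal \<epsilon>"
    using dist_le ac by (simp add: suplog_dist_def)
  have "AE x in Q. ereal \<bar>ln (enn2real (?r x))\<bar> \<le> ereal \<epsilon>"
    using esssup_AE by (rule eventually_mono) (rule order_trans[OF _ sup_le])
  moreover have "AE x in Q. ?r x \<noteq> \<infinity>"
    using ac sets by (intro Q.RN_deriv_finite P.sigma_finite_measure_axioms) auto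
  moreover have "AE x in Q. 0 < ?r x"
  proof (rule absolutely_continuous_AE[OF sets[symmetric] ac(1)])
    have "AE x in density Q ?r. 0 < ?r x" by (subst AE_density) auto
    then show "AE x in P. 0 < ?r x" by (simp only: Q.density_RN_deriv[OF ac(2) sets])
  qed
  ultimately show ?thesis
  proof eventually_elim
    case (elim x)
    then obtain t where RN_eq: "?r x = ennreal t" "0 < t" by (cases "?r x") auto
    then have "\<bar>ln t\<bar> \<le> \<epsilon>" using elim by simp
    then have "exp (- \<epsilon>) \<le> exp (ln t)" "exp (ln t) \<le> exp \<epsilon>" by auto
    then show ?case using RN_eq by (simp add: ennreal_leI)
  qed
qed

lemma suplog_dist_le_imp_measure_bounds:
  assumes PQ_Dists: "P \<in> Dists" "Q \<in> Dists" and dist_le: "suplog_dist P Q \<le> ereal \<epsilon>"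
    and A_sets: "A \<in> sets borel"
  shows "exp (- \<epsilon>) * measure Q A \<le> measure P A" "measure P A \<le> exp \<epsilon> * measure Q A"
proof -
  interpret P: prob_space P using PQ_Dists(1) by (rule prob_space_Dists)
  interpret Q: prob_space Q using PQ_Dists(2) by (rule prob_space_Dists)
  have sets: "sets P = sets Q" "A \<in> sets Q" using PQ_Dists A_sets by (simp_all add: sets_Dists)
  have scale: "(\<integral>\<^sup>+x. ennreal (exp s) * indicator A x \<partial>Q) = ennreal (exp s * measure Q A)" for s
    using sets(2) by (simp add: nn_integral_cmult_indicator Q.emeasure_eq_measure ennreal_mult)
  note ac = suplog_dist_le_imp_absolutely_continuous(2)[OF dist_le]
  have integral_RN_deriv: "(\<integral>\<^sup>+x. RN_deriv Q P x * indicator A x \<partial>Q) = ennreal (measure P A)"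
    using Q.RN_deriv_nn_integral[OF ac sets(1), of "indicator A"] sets
    by (simp add: P.emeasure_eq_measure)
  note bounds = suplog_dist_le_imp_RN_deriv_bounds[OF PQ_Dists dist_le]
  have "ennreal (exp (- \<epsilon>) * measure Q A) \<le> ennreal (measure P A)"
    unfolding scale[symmetric] integral_RN_deriv[symmetric]
    by (rule nn_integral_mono_AE, use bounds in eventually_elim) (auto simp: indicator_def)
  then show "exp (- \<epsilon>) * measure Q A \<le> measure P A" by simp
  have "ennreal (measure P A) \<le> ennreal (exp \<epsilon> * measure Q A)"
    unfolding scale[symmetric] integral_RN_deriv[symmetric]
    by (rule nn_integral_mono_AE, use bounds in eventually_elim) (auto simp: indicator_def)
  then show "measure P A \<le> exp \<epsilon> * measure Q A" by simp
qed

lemma suplog_dist_ge: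
  assumes PQ_Dists: "P \<in> Dists" "Q \<in> Dists" and event: "A \<in> sets borel" "0 < measure P A"
  shows "ereal \<bar>ln (measure P A) - ln (measure Q A)\<bar> \<le> suplog_dist P Q"
proof (rule ereal_le_real)
  fix \<epsilon> assume "suplog_dist P Q \<le> ereal \<epsilon>"
  note bounds = suplog_dist_le_imp_measure_bounds[OF PQ_Dists this event(1)]
  have "0 < exp \<epsilon> * measure Q A" using event(2) bounds(2) by linarith
  then have Q_pos: "0 < measure Q A" by (simp add: zero_less_mult_iff)
  have "ln (exp (- \<epsilon>) * measure Q A) \<le> ln (measure P A)"
    "ln (measure P A) \<le> ln (exp \<epsilon> * measure Q A)"
    using bounds event(2) Q_pos by (auto intro!: ln_mono)
  then show "ereal \<bar>ln (measure P A) - ln (measure Q A)\<bar> \<le> ereal \<epsilon>"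
    using Q_pos by (simp add: ln_mult)
qed

section \<open>Functionals supported in a half of the cube\<close>

lemma integral_Pf:
  fixes u :: "real^'d \<Rightarrow> real"
  assumes "continuous_on cube f" "u \<in> borel_measurable borel"
  shows "(LINT x|Pf f. u x) = (LINT x|lborel. pdf f x * u x)"
  unfolding Pf_eq_density using assms borel_measurable_pdf[OF assms(1)] pdf_nonneg[OF assms(1)]
  by (subst integral_density) auto

lemma integral_Pf_eq_divide_Zf:
  fixes u :: "real^'d \<Rightarrow> real"
  assumes f_zero: "continuous_on cube f" "\<And>x. x \<in> A \<Longrightarrow> f x = 0"
    and u_zero: "u \<in> borel_measurable borel" "\<And>x. x \<notin> A \<Longrightarrow> u x = 0"
  shows "(LINT x|Pf f. u x) = (LINT x|Pf (\<lambda>_. 0). u x) / Zf f"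
proof -
  have "pdf f x * u x = pdf (\<lambda>_. 0) x * u x / Zf f" for x
    using f_zero(2)[of x] u_zero(2)[of x] by (cases "x \<in> A") (auto simp: pdf_def Zf_zero)
  then show ?thesis
    by (simp add: integral_Pf[OF f_zero(1) u_zero(1)] integral_Pf[OF continuous_on_const u_zero(1)])
qed

lemma integral_Pf_pos:
  fixes u :: "real^'d \<Rightarrow> real"
  assumes cont: "continuous_on cube f"
    and u_bounds: "u \<in> borel_measurable borel" "\<And>x. 0 \<le> u x" "\<And>x. u x \<le> 1"
    and pos: "\<And>x. x \<in> right_half i \<Longrightarrow> 0 < u x"
  shows "0 < (LINT x|Pf f. u x)"
proof (rule ccontr)
  let ?E = "cbox (\<chi> j. 3/4) 1 :: (real^'d) set"
  assume "\<not> 0 < (LINT x|Pf f. u x)"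
  then have "(LINT x|lborel. pdf f x * u x) \<le> 0" by (simp add: integral_Pf[OF cont u_bounds(1)])
  moreover have nonneg: "0 \<le> pdf f x * u x" for x using pdf_nonneg[OF cont] u_bounds(2) by simp
  ultimately have "(LINT x|lborel. pdf f x * u x) = 0"
    by (intro antisym Bochner_Integration.integral_nonneg) auto
  moreover have "integrable lborel (\<lambda>x. pdf f x * u x)"
    using borel_measurable_pdf[OF cont] pdf_nonneg[OF cont] u_bounds
    by (intro Bochner_Integration.integrable_bound[OF integrable_pdf[OF cont]] AE_I2)
       (auto simp: abs_mult mult_left_le)
  ultimately have "AE x in lborel. pdf f x * u x = 0"
    using integral_nonneg_eq_0_iff_AE[of lborel "\<lambda>x. pdf f x * u x"] nonneg by simp
  then have "AE x in lborel. x \<notin> ?E"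
  proof eventually_elim
    case (elim x)
    show ?case
    proof
      assume "x \<in> ?E"
      then have x_core: "3/4 \<le> x $ j" "x $ j \<le> 1" for j by (auto simp: mem_box_cart)
      then have "1/2 < x $ i" using x_core(1)[of i] by linarith
      then have "x \<in> right_half i" by (simp add: right_half_def)
      moreover have "0 \<le> x $ j" for j using x_core(1)[of j] by linarith
      then have "x \<in> cube" using x_core(2) by (simp add: cube_def)
      ultimately show False
        using elim pos pdf_eq_exp[OF cont, of x] by (metis exp_gt_zero less_irrefl mult_pos_pos)
    qed
  qed
  then have "measure lborel ?E = 0" by (simp add: AE_iff_measurable[OF _ refl] measure_def)
  moreover have "measure lborel ?E = (\<Prod>j\<in>(UNIV::'d set). 1/4)"
    by (subst content_cbox_cart) (auto simp: interval_ne_empty_cart)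
  ultimately show False by simp
qed

lemma right_half_borel [measurable]: "right_half i \<in> sets borel"
  unfolding right_half_def by measurable

lemma measure_Pf_eq_integral:
  "A \<in> sets borel \<Longrightarrow> measure (Pf f) A = (LINT x|Pf f. indicator A x)"
  using sets_eq_imp_space_eq[of "Pf f" borel] by (simp add: Pf_def)

lemma measure_Pf_right_half_pos:
  "continuous_on cube f \<Longrightarrow> 0 < measure (Pf f) (right_half i)"
  unfolding measure_Pf_eq_integral[OF right_half_borel] by (rule integral_Pf_pos[where i = i]) auto

lemma measure_Pf_right_half:
  assumes "continuous_on cube f" "\<And>x. x \<in> right_half i \<Longrightarrow> f x = 0"
  shows "measure (Pf f) (right_half i) = measure (Pf (\<lambda>_. 0)) (right_half i) / Zf f"
  unfolding measure_Pf_eq_integral[OF right_half_borel]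
  by (rule integral_Pf_eq_divide_Zf[where A = "right_half i", OF assms]) auto

definition ramp :: "'d \<Rightarrow> real^'d \<Rightarrow> real" where
  "ramp i x = min 1 (max 0 (x $ i - 1/2))"

lemma bounded_ramp: "bounded (range (ramp i))"
  by (rule boundedI[of _ 1]) (auto simp: ramp_def)

lemma lipschitz_on_ramp: "1-lipschitz_on UNIV (ramp i)"
proof (rule lipschitz_onI)
  fix x y :: "real^'a"
  have "\<bar>ramp i x - ramp i y\<bar> \<le> \<bar>(x - y) $ i\<bar>" by (auto simp: ramp_def)
  also have "\<dots> \<le> norm (x - y)" by (rule component_le_norm_cart)
  finally show "dist (ramp i x) (ramp i y) \<le> 1 * dist x y" by (simp add: dist_norm)
qed simp

lemma borel_measurable_ramp: "ramp i \<in> borel_measurable borel"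
  using lipschitz_on_continuous_on[OF lipschitz_on_ramp] by (rule borel_measurable_continuous_onI)

lemma integral_ramp_pos: "continuous_on cube f \<Longrightarrow> 0 < (LINT x|Pf f. ramp i x)"
  by (rule integral_Pf_pos[where i = i, OF _ borel_measurable_ramp])
    (auto simp: ramp_def right_half_def)

lemma integral_ramp_Pf:
  assumes "continuous_on cube f" "\<And>x. x \<in> right_half i \<Longrightarrow> f x = 0"
  shows "(LINT x|Pf f. ramp i x) = (LINT x|Pf (\<lambda>_. 0). ramp i x) / Zf f"
  by (rule integral_Pf_eq_divide_Zf[where A = "right_half i", OF assms borel_measurable_ramp])
    (auto simp: ramp_def right_half_def)

section \<open>Minimal errors\<close>

lemma err_ad_le_err_na:
  assumes "X \<noteq> {}"
  shows "err_ad n X F S Out D \<le> err_na n X F S Out D"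
  unfolding err_na_def
proof (intro INF_greatest)
  fix xs and \<phi> :: "real list \<Rightarrow> 'b"
  assume xs_in: "xs \<in> {xs. length xs = n \<and> set xs \<subseteq> X}" and \<phi>_Out: "\<phi> \<in> {\<phi>. \<forall>v. \<phi> v \<in> Out}"
  obtain x0 where x0_in: "x0 \<in> X" using assms by blast
  define pt where "pt v = (if length v < n then xs ! length v else x0)" for v :: "real list"
  have "ad_info pt f k = map f (take k xs)" if "k \<le> n" for f k
    using that xs_in by (induction k) (auto simp: pt_def take_Suc_conv_app_nth)
  from this[of n] have info: "ad_info pt f n = map f xs" for f using xs_in by simp
  have pt_in: "pt \<in> {pt. \<forall>v. pt v \<in> X}" using xs_in x0_in by (auto simp: pt_def)
  have "err_ad n X F S Out D \<le> (SUP f\<in>F. D (S f) (\<phi> (ad_info pt f n)))"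
    unfolding err_ad_def by (rule INF_lower2[OF pt_in], rule INF_lower2[OF \<phi>_Out]) simp
  then show "err_ad n X F S Out D \<le> (SUP f\<in>F. D (S f) (\<phi> (map f xs)))" by (simp add: info)
qed

lemma err_na_le:
  assumes xs_in: "length xs = n" "set xs \<subseteq> X" and F_Out: "F \<noteq> {}" "\<And>f. f \<in> F \<Longrightarrow> S f \<in> Out"
    and consistent: "\<And>f g. f \<in> F \<Longrightarrow> g \<in> F \<Longrightarrow> (\<And>x. x \<in> set xs \<Longrightarrow> f x = g x) \<Longrightarrow> D (S f) (S g) \<le> e"
  shows "err_na n X F S Out D \<le> e"
proof -
  have "\<exists>g\<in>F. \<forall>f\<in>F. map f xs = v \<longrightarrow> map g xs = v" for v using F_Out(1) by blast
  then obtain sel where sel_consistent: "\<And>v. sel v \<in> F"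
      "\<And>v f. f \<in> F \<Longrightarrow> map f xs = v \<Longrightarrow> map (sel v) xs = v"
    by metis
  have "(\<lambda>v. S (sel v)) \<in> {\<phi>. \<forall>v. \<phi> v \<in> Out}" using sel_consistent(1) F_Out(2) by blast
  then have "err_na n X F S Out D \<le> (SUP f\<in>F. D (S f) (S (sel (map f xs))))"
    unfolding err_na_def using xs_in by (intro INF_lower2[of xs] INF_lower) auto
  also have "\<dots> \<le> e"
  proof (rule SUP_least)
    fix f assume f_in: "f \<in> F"
    have "map (sel (map f xs)) xs = map f xs" using sel_consistent(2)[OF f_in] by blast
    then show "D (S f) (S (sel (map f xs))) \<le> e"
      using consistent[OF f_in sel_consistent(1)] by (metis map_eq_conv)
  qed
  finally show ?thesis .
qed

text \<open>The Lipschitz functional \<open>\<Phi>\<close> replaces the triangle inequality, which \<open>D\<close> need not satisfy.\<close>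

lemma err_ad_ge:
  fixes \<Phi> :: "'o \<Rightarrow> real"
  assumes g_in: "g \<in> F"
    and fool: "\<And>pts. finite pts \<Longrightarrow> card pts \<le> n \<Longrightarrow>
      \<exists>f\<in>F. (\<forall>x\<in>pts. f x = g x) \<and> 2 * e \<le> \<bar>\<Phi> (S f) - \<Phi> (S g)\<bar>"
    and lip: "\<And>f Q. f \<in> F \<Longrightarrow> Q \<in> Out \<Longrightarrow> ereal \<bar>\<Phi> (S f) - \<Phi> Q\<bar> \<le> D (S f) Q"
  shows "ereal e \<le> err_ad n X F S Out D"
  unfolding err_ad_def
proof (intro INF_greatest)
  fix pt and \<phi> :: "real list \<Rightarrow> 'o" assume "\<phi> \<in> {\<phi>. \<forall>v. \<phi> v \<in> Out}"
  let ?pts = "(\<lambda>k. pt (ad_info pt g k)) ` {..<n}" and ?Q = "\<phi> (ad_info pt g n)"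
  have "card ?pts \<le> n" using card_image_le[of "{..<n}"] by (metis card_lessThan finite_lessThan)
  with fool[of ?pts] obtain f where f_fools: "f \<in> F" "\<And>x. x \<in> ?pts \<Longrightarrow> f x = g x"
    and gap: "2 * e \<le> \<bar>\<Phi> (S f) - \<Phi> (S g)\<bar>" by auto
  have "ad_info pt f k = ad_info pt g k" if "k \<le> n" for k
    using that by (induction k) (use f_fools(2) in auto)
  then have info: "ad_info pt f n = ad_info pt g n" by simp
  have "e \<le> \<bar>\<Phi> (S f) - \<Phi> ?Q\<bar> \<or> e \<le> \<bar>\<Phi> (S g) - \<Phi> ?Q\<bar>" using gap by linarith
  then obtain f' where far: "f' \<in> F" "ad_info pt f' n = ad_info pt g n" "e \<le> \<bar>\<Phi> (S f') - \<Phi> ?Q\<bar>"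
    using f_fools(1) g_in info by blast
  then have "ereal e \<le> ereal \<bar>\<Phi> (S f') - \<Phi> ?Q\<bar>" by simp
  also have "\<dots> \<le> D (S f') ?Q" using far(1) \<open>\<phi> \<in> _\<close> by (intro lip) auto
  also have "\<dots> \<le> (SUP f\<in>F. D (S f) (\<phi> (ad_info pt f n)))"
    using far(1,2) by (intro SUP_upper2[of f']) auto
  finally show "ereal e \<le> (SUP f\<in>F. D (S f) (\<phi> (ad_info pt f n)))" .
qed

lemma zero_in_Fcls: "0 < B \<Longrightarrow> (\<lambda>_. 0) \<in> Fcls m B"
  by (simp add: Fcls_def Cm_bdd_zero)

lemma Fcls_imp_continuous_on: "f \<in> Fcls m B \<Longrightarrow> continuous_on cube f"
  by (auto simp: Fcls_def dest: Cm_bdd_imp_continuous_on)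

lemma err_na_Fcls_le:
  fixes S :: "(real^'d \<Rightarrow> real) \<Rightarrow> 'o"
  assumes stable: "\<And>f g \<delta>. uniformly_close \<delta> f g \<Longrightarrow> 0 < \<delta> \<Longrightarrow> D (S f) (S g) \<le> ereal (\<psi> \<delta>)"
    and Out: "\<And>f. continuous_on cube f \<Longrightarrow> S f \<in> Out" and "0 < B" "1 \<le> n"
  shows "err_na n cube (Fcls m B) S Out D
      \<le> ereal (\<psi> (2 * sampling_const TYPE('d) m * rate TYPE('d) m B n))"
proof -
  obtain xs :: "(real^'d) list" where xs_in: "length xs = n" "set xs \<subseteq> cube"
    and sampling: "\<And>B h x. Cm_bdd m B cube h \<Longrightarrow> (\<And>y. y \<in> set xs \<Longrightarrow> h y = 0) \<Longrightarrow> x \<in> cube \<Longrightarrow>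
       \<bar>h x\<bar> \<le> sampling_const TYPE('d) m * rate TYPE('d) m B n"
    using sampling_points_exist[OF \<open>1 \<le> n\<close>] by blast
  let ?\<delta> = "2 * sampling_const TYPE('d) m * rate TYPE('d) m B n"
  show ?thesis
  proof (rule err_na_le[OF xs_in])
    show "Fcls m B \<noteq> ({} :: (real^'d \<Rightarrow> real) set)" using zero_in_Fcls[OF \<open>0 < B\<close>] by blast
    show "S f \<in> Out" if "f \<in> Fcls m B" for f using Out Fcls_imp_continuous_on[OF that] .
    fix f g :: "real^'d \<Rightarrow> real"
    assume fg_in: "f \<in> Fcls m B" "g \<in> Fcls m B" and agree: "\<And>x. x \<in> set xs \<Longrightarrow> f x = g x"
    have Cm_diff: "Cm_bdd m (B + B) cube (\<lambda>x. f x - g x)"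
      using fg_in unfolding Fcls_def by (intro Cm_bdd_diff) auto
    have "\<bar>f x - g x\<bar> \<le> ?\<delta>" if "x \<in> cube" for x
      using sampling[OF Cm_diff _ that] agree by (simp add: rate_def algebra_simps)
    then have "uniformly_close ?\<delta> f g"
      using fg_in by (simp add: uniformly_close_def Fcls_imp_continuous_on)
    moreover have "0 < ?\<delta>"
      using \<open>0 < B\<close> \<open>1 \<le> n\<close> by (simp add: sampling_const_pos rate_pos)
    ultimately show "D (S f) (S g) \<le> ereal (\<psi> ?\<delta>)" by (rule stable)
  qed
qed

lemma err_ad_Fcls_ge:
  fixes S :: "(real^'d \<Rightarrow> real) \<Rightarrow> 'o" and \<Phi> :: "'o \<Rightarrow> real"
  assumes lip: "\<And>f Q. continuous_on cube f \<Longrightarrow> Q \<in> Out \<Longrightarrow> ereal \<bar>\<Phi> (S f) - \<Phi> Q\<bar> \<le> D (S f) Q"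
    and gap: "\<And>f y. continuous_on cube f \<Longrightarrow> (\<And>x. x \<in> right_half i \<Longrightarrow> f x = 0) \<Longrightarrow> 0 < y \<Longrightarrow>
       exp y \<le> Zf f \<Longrightarrow> \<psi> y \<le> \<bar>\<Phi> (S f) - \<Phi> (S (\<lambda>_. 0))\<bar>"
    and "0 < B" "1 \<le> n"
  shows "ereal (\<psi> (fooling_const TYPE('d) m * rate TYPE('d) m B n) / 2)
      \<le> err_ad n cube (Fcls m B) S Out D"
proof (rule err_ad_ge[where \<Phi> = \<Phi>, OF zero_in_Fcls[OF \<open>0 < B\<close>]])
  let ?y = "fooling_const TYPE('d) m * rate TYPE('d) m B n"
  fix pts :: "(real^'d) set" assume pts: "finite pts" "card pts \<le> n"
  obtain f where fooling: "Cm_bdd m B cube f" "\<And>x. x \<in> pts \<union> right_half i \<Longrightarrow> f x = 0"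
      "?y \<le> (LINT x:cube|lborel. f x)"
    using fooling_function_exists[OF \<open>0 < B\<close> \<open>1 \<le> n\<close> pts] by blast
  have cont: "continuous_on cube f" using fooling(1) by (rule Cm_bdd_imp_continuous_on)
  have "0 < ?y" using \<open>0 < B\<close> \<open>1 \<le> n\<close> by (simp add: fooling_const_pos rate_pos)
  moreover have "exp ?y \<le> exp (LINT x:cube|lborel. f x)" using fooling(3) by simp
  then have "exp ?y \<le> Zf f" using exp_set_integral_le_Zf[OF cont] by (rule order_trans)
  ultimately have "\<psi> ?y \<le> \<bar>\<Phi> (S f) - \<Phi> (S (\<lambda>_. 0))\<bar>" using cont fooling(2) by (intro gap) auto
  then show "\<exists>f\<in>Fcls m B. (\<forall>x\<in>pts. f x = 0) \<and> 2 * (\<psi> ?y / 2) \<le> \<bar>\<Phi> (S f) - \<Phi> (S (\<lambda>_. 0))\<bar>"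
    using fooling(1,2) by (intro bexI[of _ f]) (auto simp: Fcls_def)
qed (use lip Fcls_imp_continuous_on in blast)

section \<open>Rates\<close>

lemma Theta_pairI:
  assumes upper_e1: "0 < C" "\<And>B n. 0 < B \<Longrightarrow> 1 \<le> n \<Longrightarrow> e1 B n \<le> ereal (C * h B n)"
    and lower_e2: "0 < c" "\<And>B n. 0 < B \<Longrightarrow> 1 \<le> n \<Longrightarrow> ereal (c * h B n) \<le> e2 B n"
    and e2_le_e1: "\<And>B n. e2 B n \<le> e1 B n"
  shows "Theta e1 h \<and> Theta e2 h"
proof -
  have lower: "ereal (h B n) \<le> ereal (1 / c) * e" if "0 < B" "1 \<le> n" "e2 B n \<le> e" for B n e
  proof -
    have "ereal (h B n) = ereal (1 / c) * ereal (c * h B n)" using lower_e2(1) by simp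
    also have "\<dots> \<le> ereal (1 / c) * e"
      using lower_e2 that by (intro ereal_mult_left_mono) (auto intro: order_trans)
    finally show ?thesis .
  qed
  have upper: "e2 B n \<le> ereal (C * h B n)" if "0 < B" "1 \<le> n" for B n
    using upper_e1(2)[OF that] e2_le_e1[of B n] by (rule order_trans[rotated])
  have "Theta e1 h"
    unfolding Theta_def using upper_e1 lower_e2(1) lower e2_le_e1
    by (intro conjI exI[of _ C] exI[of _ "1 / c"]) auto
  moreover have "Theta e2 h"
    unfolding Theta_def using upper_e1(1) upper lower_e2(1) lower
    by (intro conjI exI[of _ C] exI[of _ "1 / c"]) auto
  ultimately show ?thesis ..
qed

definition linearly_scaling :: "(real \<Rightarrow> real) \<Rightarrow> bool" where
  "linearly_scaling h \<longleftrightarrow> (\<forall>c>0. \<forall>y>0. h (c * y) \<le> (1 + c) * h y)"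

lemma linearly_scaling_ident: "linearly_scaling (\<lambda>y. y)"
  by (simp add: linearly_scaling_def algebra_simps)

lemma linearly_scaling_min_one: "linearly_scaling (min 1)"
  by (auto simp: linearly_scaling_def min_def algebra_simps mult_left_le)

lemma linearly_scaling_le: "linearly_scaling h \<Longrightarrow> 0 < c \<Longrightarrow> 0 < y \<Longrightarrow> h (c * y) \<le> (1 + c) * h y"
  by (simp add: linearly_scaling_def)

lemma linearly_scaling_ge:
  assumes "linearly_scaling h" "0 < c" "0 < y"
  shows "h y / (1 + 1 / c) \<le> h (c * y)"
proof -
  have "h y \<le> (1 + 1 / c) * h (c * y)"
    using linearly_scaling_le[OF assms(1), of "1 / c" "c * y"] assms(2,3) by simp
  moreover have "0 < 1 + 1 / c" using assms(2) by (simp add: add_pos_pos)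
  ultimately show ?thesis by (simp only: pos_divide_le_eq mult.commute)
qed

definition minimal_errors_Theta ::
  "nat \<Rightarrow> ((real^'d \<Rightarrow> real) \<Rightarrow> 'o) \<Rightarrow> 'o set \<Rightarrow> ('o \<Rightarrow> 'o \<Rightarrow> ereal) \<Rightarrow> (real \<Rightarrow> nat \<Rightarrow> real) \<Rightarrow> bool" where
  "minimal_errors_Theta m S Out D h \<longleftrightarrow>
     Theta (\<lambda>B n. err_na n cube (Fcls m B) S Out D) h \<and>
     Theta (\<lambda>B n. err_ad n cube (Fcls m B) S Out D) h"

lemma minimal_errors_ThetaI:
  fixes S :: "(real^'d \<Rightarrow> real) \<Rightarrow> 'o" and \<Phi> :: "'o \<Rightarrow> real"
  assumes scaling: "linearly_scaling h" and "0 < a" "0 < b"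
    and Out: "\<And>f. continuous_on cube f \<Longrightarrow> S f \<in> Out"
    and stable: "\<And>f g \<delta>. uniformly_close \<delta> f g \<Longrightarrow> 0 < \<delta> \<Longrightarrow> D (S f) (S g) \<le> ereal (b * h \<delta>)"
    and lip: "\<And>f Q. continuous_on cube f \<Longrightarrow> Q \<in> Out \<Longrightarrow> ereal \<bar>\<Phi> (S f) - \<Phi> Q\<bar> \<le> D (S f) Q"
    and gap: "\<And>f y. continuous_on cube f \<Longrightarrow> (\<And>x. x \<in> right_half i \<Longrightarrow> f x = 0) \<Longrightarrow> 0 < y \<Longrightarrow>
       exp y \<le> Zf f \<Longrightarrow> a * h y \<le> \<bar>\<Phi> (S f) - \<Phi> (S (\<lambda>_. 0))\<bar>"
  shows "minimal_errors_Theta m S Out D (\<lambda>B n. h (rate TYPE('d) m B n))"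
proof -
  let ?r = "rate TYPE('d) m" and ?C = "2 * sampling_const TYPE('d) m"
    and ?c = "fooling_const TYPE('d) m"
  have C_pos: "0 < ?C" and c_pos: "0 < ?c" by (simp_all add: sampling_const_pos fooling_const_pos)
  have upper: "err_na n cube (Fcls m B) S Out D \<le> ereal (b * (1 + ?C) * h (?r B n))"
    if "0 < B" "1 \<le> n" for B n
  proof -
    have "err_na n cube (Fcls m B) S Out D \<le> ereal (b * h (?C * ?r B n))"
      using stable Out that by (rule err_na_Fcls_le)
    also have "b * h (?C * ?r B n) \<le> b * ((1 + ?C) * h (?r B n))"
      using linearly_scaling_le[OF scaling C_pos rate_pos[OF that]] \<open>0 < b\<close>
      by (intro mult_left_mono) auto
    finally show ?thesis by (simp add: mult.assoc)
  qed
  have lower: "ereal (a / (2 * (1 + 1 / ?c)) * h (?r B n)) \<le> err_ad n cube (Fcls m B) S Out D"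
    if "0 < B" "1 \<le> n" for B n
  proof -
    have "a / 2 * (h (?r B n) / (1 + 1 / ?c)) \<le> a / 2 * h (?c * ?r B n)"
      using linearly_scaling_ge[OF scaling c_pos rate_pos[OF that]] \<open>0 < a\<close>
      by (intro mult_left_mono) auto
    then have "ereal (a / (2 * (1 + 1 / ?c)) * h (?r B n)) \<le> ereal (a * h (?c * ?r B n) / 2)"
      by simp
    also have "\<dots> \<le> err_ad n cube (Fcls m B) S Out D"
      using lip gap that by (rule err_ad_Fcls_ge)
    finally show ?thesis .
  qed
  show ?thesis
    unfolding minimal_errors_Theta_def
  proof (rule Theta_pairI[OF _ upper _ lower])
    show "0 < b * (1 + ?C)" using C_pos \<open>0 < b\<close> by simp
    show "0 < a / (2 * (1 + 1 / ?c))" using c_pos \<open>0 < a\<close> by (simp add: add_pos_pos)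
    show "err_ad n cube (Fcls m B) S Out D \<le> err_na n cube (Fcls m B) S Out D" for B n
      using zero_in_cube by (intro err_ad_le_err_na) blast
  qed
qed

lemma le_Lf_of_exp_le_Zf: "exp y \<le> Zf f \<Longrightarrow> y \<le> Lf f"
  using ln_mono[of "exp y" "Zf f"] by (simp add: Lf_def)

lemma Lf_minimal_errors:
  "minimal_errors_Theta m (Lf :: (real^'d \<Rightarrow> real) \<Rightarrow> real) UNIV abs_dist (rate TYPE('d) m)"
proof (rule minimal_errors_ThetaI[where h = "\<lambda>y. y" and a = 1 and b = 1 and \<Phi> = "\<lambda>y. y"])
  fix f :: "real^'d \<Rightarrow> real" and y assume "exp y \<le> Zf f"
  then show "1 * y \<le> \<bar>Lf f - Lf (\<lambda>_. 0)\<bar>"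
    using le_Lf_of_exp_le_Zf[of y f] by (simp add: Lf_def Zf_zero)
qed (auto simp: linearly_scaling_ident abs_dist_def abs_Lf_diff_le)

lemma Pf_suplog_minimal_errors:
  "minimal_errors_Theta m (Pf :: (real^'d \<Rightarrow> real) \<Rightarrow> _) Dists suplog_dist (rate TYPE('d) m)"
proof -
  let ?H = "right_half (undefined :: 'd)"
  show ?thesis
  proof (rule minimal_errors_ThetaI[where h = "\<lambda>y. y" and a = 1 and b = 2
    and \<Phi> = "\<lambda>P. ln (measure P ?H)"])
    show "ereal \<bar>ln (measure (Pf f) ?H) - ln (measure Q ?H)\<bar> \<le> suplog_dist (Pf f) Q"
      if "continuous_on cube f" "Q \<in> Dists" for f Q
      using that by (intro suplog_dist_ge Pf_in_Dists measure_Pf_right_half_pos right_half_borel)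
    fix f :: "real^'d \<Rightarrow> real" and y
    assume f_zero: "continuous_on cube f" "\<And>x. x \<in> ?H \<Longrightarrow> f x = 0" and exp_le: "exp y \<le> Zf f"
    have "0 < measure (Pf (\<lambda>_. 0)) ?H" by (rule measure_Pf_right_half_pos) simp
    then have "ln (measure (Pf f) ?H) = ln (measure (Pf (\<lambda>_. 0)) ?H) - Lf f"
      using Zf_pos[OF f_zero(1)] by (simp add: measure_Pf_right_half[OF f_zero] Lf_def ln_div)
    then show "1 * y \<le> \<bar>ln (measure (Pf f) ?H) - ln (measure (Pf (\<lambda>_. 0)) ?H)\<bar>"
      using le_Lf_of_exp_le_Zf[OF exp_le] by simp
  qed (simp_all add: linearly_scaling_ident suplog_dist_Pf_le Pf_in_Dists)
qed

lemma min_one_half_le_one_minus_inverse: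
  fixes y z :: real
  assumes "0 < y" "exp y \<le> z"
  shows "min 1 y / 2 \<le> 1 - 1 / z"
proof -
  have z_ge: "1 + y \<le> z" using exp_ge_add_one_self[of y] assms by linarith
  have "1 / z \<le> 1 / (1 + y)" using z_ge assms by (intro divide_left_mono) auto
  moreover have "min 1 y / 2 \<le> y / (1 + y)"
    using assms by (auto simp: min_def field_simps intro: mult_left_le)
  moreover have "y / (1 + y) = 1 - 1 / (1 + y)" using assms by (simp add: field_simps)
  ultimately show ?thesis by linarith
qed

lemma Pf_minimal_errors_min:
  fixes D :: "(real^'d) measure \<Rightarrow> (real^'d) measure \<Rightarrow> ereal" and \<Phi> :: "(real^'d) measure \<Rightarrow> real"
  assumes "0 < b"
    and stable: "\<And>f g \<delta>. uniformly_close \<delta> f g \<Longrightarrow> 0 < \<delta> \<Longrightarrow> D (Pf f) (Pf g) \<le> ereal (b * min 1 \<delta>)"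
    and lip: "\<And>P Q. P \<in> Dists \<Longrightarrow> Q \<in> Dists \<Longrightarrow> ereal \<bar>\<Phi> P - \<Phi> Q\<bar> \<le> D P Q"
    and pos: "0 < \<Phi> (Pf (\<lambda>_. 0))"
    and \<Phi>_scale: "\<And>f. continuous_on cube f \<Longrightarrow> (\<And>x. x \<in> right_half i \<Longrightarrow> f x = 0) \<Longrightarrow>
       \<Phi> (Pf f) = \<Phi> (Pf (\<lambda>_. 0)) / Zf f"
  shows "minimal_errors_Theta m Pf Dists D (\<lambda>B n. min 1 (rate TYPE('d) m B n))"
proof (rule minimal_errors_ThetaI[where a = "\<Phi> (Pf (\<lambda>_. 0)) / 2" and b = b and \<Phi> = \<Phi> and i = i])
  fix f :: "real^'d \<Rightarrow> real" and y
  assume f_zero: "continuous_on cube f" "\<And>x. x \<in> right_half i \<Longrightarrow> f x = 0"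
    and exp_le: "0 < y" "exp y \<le> Zf f"
  let ?k = "\<Phi> (Pf (\<lambda>_. 0))"
  have "?k / 2 * min 1 y \<le> ?k * (1 - 1 / Zf f)"
    using mult_left_mono[OF min_one_half_le_one_minus_inverse[OF exp_le], of ?k] pos by simp
  also have "\<dots> = - (\<Phi> (Pf f) - ?k)" by (simp add: \<Phi>_scale[OF f_zero] algebra_simps)
  finally show "?k / 2 * min 1 y \<le> \<bar>\<Phi> (Pf f) - ?k\<bar>" by linarith
qed (use \<open>0 < b\<close> pos in \<open>simp_all add: linearly_scaling_min_one stable lip Pf_in_Dists\<close>)

lemma Pf_tv_minimal_errors:
  "minimal_errors_Theta m (Pf :: (real^'d \<Rightarrow> real) \<Rightarrow> _) Dists tv_dist
    (\<lambda>B n. min 1 (rate TYPE('d) m B n))"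
proof (rule Pf_minimal_errors_min[where b = 2])
  let ?H = "right_half (undefined :: 'd)"
  show "ereal \<bar>measure P ?H - measure Q ?H\<bar> \<le> tv_dist P Q" if "P \<in> Dists" "Q \<in> Dists" for P Q
    using that right_half_borel by (rule tv_dist_ge)
  show "0 < measure (Pf (\<lambda>_. 0)) ?H" by (rule measure_Pf_right_half_pos) simp
  show "measure (Pf f) ?H = measure (Pf (\<lambda>_. 0)) ?H / Zf f"
    if "continuous_on cube f" "\<And>x. x \<in> ?H \<Longrightarrow> f x = 0" for f
    using that by (rule measure_Pf_right_half)
qed (simp_all add: tv_dist_Pf_le)

lemma Pf_w1_minimal_errors:
  "minimal_errors_Theta m (Pf :: (real^'d \<Rightarrow> real) \<Rightarrow> _) Dists w1_dist
    (\<lambda>B n. min 1 (rate TYPE('d) m B n))"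
proof (rule Pf_minimal_errors_min[where b = "2 * real CARD('d)"])
  let ?u = "ramp (undefined :: 'd)"
  show "ereal \<bar>(LINT x|P. ?u x) - (LINT x|Q. ?u x)\<bar> \<le> w1_dist P Q" for P Q
    using lipschitz_on_ramp bounded_ramp by (rule w1_dist_ge)
  show "0 < (LINT x|Pf (\<lambda>_. 0). ?u x)" by (rule integral_ramp_pos) simp
  show "(LINT x|Pf f. ?u x) = (LINT x|Pf (\<lambda>_. 0). ?u x) / Zf f"
    if "continuous_on cube f" "\<And>x. x \<in> right_half undefined \<Longrightarrow> f x = 0" for f
    using that by (rule integral_ramp_Pf)
qed (simp_all add: w1_dist_Pf_le)

theorem theorem4:
  fixes m :: nat
  assumes "m \<ge> 1"
  shows
   "Theta (\<lambda>B n. err_na n (cube :: (real^'d) set) (Fcls m B) Lf UNIV abs_dist)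
          (\<lambda>B n. B * real n powr (- (real m / real CARD('d)))) \<and>
    Theta (\<lambda>B n. err_ad n (cube :: (real^'d) set) (Fcls m B) Lf UNIV abs_dist)
          (\<lambda>B n. B * real n powr (- (real m / real CARD('d)))) \<and>
    Theta (\<lambda>B n. err_na n (cube :: (real^'d) set) (Fcls m B) Pf Dists suplog_dist)
          (\<lambda>B n. B * real n powr (- (real m / real CARD('d)))) \<and>
    Theta (\<lambda>B n. err_ad n (cube :: (real^'d) set) (Fcls m B) Pf Dists suplog_dist)
          (\<lambda>B n. B * real n powr (- (real m / real CARD('d)))) \<and>
    Theta (\<lambda>B n. err_na n (cube :: (real^'d) set) (Fcls m B) Pf Dists tv_dist)
          (\<lambda>B n. min 1 (B * real n powr (- (real m / real CARD('d))))) \<and>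
    Theta (\<lambda>B n. err_ad n (cube :: (real^'d) set) (Fcls m B) Pf Dists tv_dist)
          (\<lambda>B n. min 1 (B * real n powr (- (real m / real CARD('d))))) \<and>
    Theta (\<lambda>B n. err_na n (cube :: (real^'d) set) (Fcls m B) Pf Dists w1_dist)
          (\<lambda>B n. min 1 (B * real n powr (- (real m / real CARD('d))))) \<and>
    Theta (\<lambda>B n. err_ad n (cube :: (real^'d) set) (Fcls m B) Pf Dists w1_dist)
          (\<lambda>B n. min 1 (B * real n powr (- (real m / real CARD('d)))))"
proof -
  have rate: "rate TYPE('d) m = (\<lambda>B n. B * real n powr (- (real m / real CARD('d))))"
    by (simp add: rate_def fun_eq_iff)
  note Lf_minimal_errors[of m, where 'd = 'd] Pf_suplog_minimal_errors[of m, where 'd = 'd]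
    Pf_tv_minimal_errors[of m, where 'd = 'd] Pf_w1_minimal_errors[of m, where 'd = 'd]
  then show ?thesis unfolding minimal_errors_Theta_def rate by blast
qed

end
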